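(* Let $G$ be a finite solvable group and let $p$ be an odd prime. If $\mathrm{acd}_{p'}(G) < \dfrac{2(p+1)}{p+3}$, then $G$ is $p$-nilpotent.
   Context: $\mathrm{Irr}(G)$ denotes the set of irreducible complex characters of the finite group $G$. For a prime $p$, $\mathrm{Irr}_{p'}(G)$ is the set of $\chi\in\mathrm{Irr}(G)$ whose degree $\chi(1)$ is not divisible by $p$, and $\mathrm{acd}_{p'}(G)=\frac{1}{|\mathrm{Irr}_{p'}(G)|}\sum_{\chi\in\mathrm{Irr}_{p'}(G)}\chi(1)$ is the average degree of these characters. $G$ is $p$-nilpotent if it has a normal $p$-complement, i.e. a normal subgroup of order prime to $p$ and of index a power of $p$. *)

theory Defs
  imports
    "HOL-Algebra.Solvable_Groups"
    "Jordan_Normal_Form.VS_Connect"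
    "HOL-Computational_Algebra.Primes"
    Complex_Main
begin

definition mat_trace :: "'a::comm_monoid_add mat \<Rightarrow> 'a" where
  "mat_trace A = (\<Sum>i<dim_row A. A $$ (i, i))"

definition GL_complex :: "nat \<Rightarrow> complex mat monoid" where
  "GL_complex n = units_of (ring_mat TYPE(complex) n ())"

text \<open>Complex representations of \<open>G\<close> of degree \<open>n\<close>, in matrix form. As usual for
  homomorphisms in HOL-Algebra, only the values on \<^term>\<open>carrier G\<close> matter.\<close>

definition matrix_representation :: "('a, 'b) monoid_scheme \<Rightarrow> nat \<Rightarrow> ('a \<Rightarrow> complex mat) \<Rightarrow> bool" where
  "matrix_representation G n \<rho> \<longleftrightarrow> \<rho> \<in> hom G (GL_complex n)"

definition invariant_subspace ::
    "('a, 'b) monoid_scheme \<Rightarrow> nat \<Rightarrow> ('a \<Rightarrow> complex mat) \<Rightarrow> complex vec set \<Rightarrow> bool" where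
  "invariant_subspace G n \<rho> W \<longleftrightarrow>
     subspace class_ring W (module_vec TYPE(complex) n) \<and>
     (\<forall>g\<in>carrier G. \<forall>w\<in>W. \<rho> g *\<^sub>v w \<in> W)"

definition irreducible_representation ::
    "('a, 'b) monoid_scheme \<Rightarrow> nat \<Rightarrow> ('a \<Rightarrow> complex mat) \<Rightarrow> bool" where
  "irreducible_representation G n \<rho> \<longleftrightarrow>
     matrix_representation G n \<rho> \<and> n > 0 \<and>
     (\<forall>W. invariant_subspace G n \<rho> W \<longrightarrow> W = {0\<^sub>v n} \<or> W = carrier_vec n)"

text \<open>Characters are made extensional (\<open>undefined\<close> outside \<^term>\<open>carrier G\<close>), so that two
  characters are equal as HOL functions iff they agree on \<open>G\<close>, and \<open>Irr\<close> below counts each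
  irreducible character exactly once.\<close>

definition character_of :: "('a, 'b) monoid_scheme \<Rightarrow> ('a \<Rightarrow> complex mat) \<Rightarrow> 'a \<Rightarrow> complex" where
  "character_of G \<rho> = (\<lambda>g\<in>carrier G. mat_trace (\<rho> g))"

definition Irr :: "('a, 'b) monoid_scheme \<Rightarrow> ('a \<Rightarrow> complex) set" where
  "Irr G = {character_of G \<rho> | n \<rho>. irreducible_representation G n \<rho>}"

text \<open>The degree \<open>\<chi>(1)\<close> as a natural number; lemma \<open>of_nat_char_degree\<close> below shows that on
  \<open>Irr G\<close> it is the value of \<open>\<chi>\<close> at the identity.\<close>

definition char_degree :: "('a, 'b) monoid_scheme \<Rightarrow> ('a \<Rightarrow> complex) \<Rightarrow> nat" where
  "char_degree G \<chi> = (THE d. \<chi> \<one>\<^bsub>G\<^esub> = of_nat d)"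

definition Irr_p' :: "nat \<Rightarrow> ('a, 'b) monoid_scheme \<Rightarrow> ('a \<Rightarrow> complex) set" where
  "Irr_p' p G = {\<chi> \<in> Irr G. \<not> p dvd char_degree G \<chi>}"

definition acd_p' :: "nat \<Rightarrow> ('a, 'b) monoid_scheme \<Rightarrow> real" where
  "acd_p' p G = (\<Sum>\<chi>\<in>Irr_p' p G. real (char_degree G \<chi>)) / real (card (Irr_p' p G))"

definition p_nilpotent :: "nat \<Rightarrow> ('a, 'b) monoid_scheme \<Rightarrow> bool" where
  "p_nilpotent p G \<longleftrightarrow>
     (\<exists>N. N \<lhd> G \<and> coprime (card N) p \<and> (\<exists>k. card (rcosets\<^bsub>G\<^esub> N) = p ^ k))"

lemma character_of_one:
  assumes "group G" and "matrix_representation G n \<rho>"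
  shows "character_of G \<rho> \<one>\<^bsub>G\<^esub> = of_nat n"
proof -
  interpret R: ring "ring_mat TYPE(complex) n ()"
    by (rule ring_mat)
  have "group (GL_complex n)"
    unfolding GL_complex_def by (rule R.units_group)
  then interpret group_hom G "GL_complex n" \<rho>
    using assms unfolding matrix_representation_def
    by (intro group_hom.intro group_hom_axioms.intro)
  have "\<rho> \<one>\<^bsub>G\<^esub> = \<one>\<^bsub>GL_complex n\<^esub>"
    by (rule hom_one)
  also have "\<dots> = 1\<^sub>m n"
    unfolding GL_complex_def units_of_def ring_mat_def by (simp only: monoid.simps ring.simps)
  finally show ?thesis
    by (simp add: character_of_def mat_trace_def)
qed

lemma of_nat_char_degree:
  assumes "group G" and "\<chi> \<in> Irr G"
  shows "of_nat (char_degree G \<chi>) = \<chi> \<one>\<^bsub>G\<^esub>"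
proof -
  obtain n \<rho> where \<chi>: "\<chi> = character_of G \<rho>" and irr: "irreducible_representation G n \<rho>"
    using assms(2) unfolding Irr_def mem_Collect_eq by (elim exE conjE)
  from irr have "matrix_representation G n \<rho>"
    unfolding irreducible_representation_def by (rule conjunct1)
  with assms(1) have "\<chi> \<one>\<^bsub>G\<^esub> = of_nat n"
    unfolding \<chi> by (rule character_of_one)
  then show ?thesis
    unfolding char_degree_def by (simp only: of_nat_eq_iff the_eq_trivial the_sym_eq_trivial)
qed

end

theory Submission
  imports Defs "HOL-Algebra.Group_Action" "HOL-Algebra.Multiplicative_Group" "HOL-Algebra.Sylow"
    "HOL-Number_Theory.Cong" "Jordan_Normal_Form.Schur_Decomposition"
begin

text \<open>Let \<open>w d = (p + 3) d - 2 (p + 1)\<close>; the hypothesis says that the sum of \<open>w (\<chi> 1)\<close> over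
  \<open>\<chi> \<in> Irr\<^sub>p\<^sub>' G\<close> is negative. Here \<open>w 1 = - (p - 1)\<close> and \<open>w d > 0\<close> for \<open>d \<ge> 2\<close>, so a quotient by a
  normal subgroup in the kernel of all linear characters inherits the hypothesis, and one may
  assume that \<open>G\<close> is not \<open>p\<close>-nilpotent while its quotients by nontrivial normal subgroups inside
  \<open>G'\<close> are. A minimal normal subgroup \<open>N \<subseteq> G'\<close> is then an elementary abelian \<open>p\<close>-group, and \<open>G\<close>
  splits over \<open>N\<close>; the splitting is recorded as a crossed homomorphism \<open>F\<close> from \<open>G\<close> to \<open>N\<close> with
  \<open>F n = n\<close> on \<open>N\<close>.

  Every orbit of size \<open>d\<close> of \<open>G\<close> on the nontrivial characters of \<open>N\<close> has \<open>d \<ge> 2\<close> and yields at least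
  \<open>|Lin G| / d\<close> irreducible characters of degree \<open>d\<close>. The number of characters of \<open>N\<close> is divisible
  by \<open>p\<close>, so the orbits of size prime to \<open>p\<close> contain at least \<open>p - 1\<close> nontrivial characters.
  Since \<open>w d \<ge> d * min d (p - 1)\<close>, the characters obtained from these orbits contribute at least
  \<open>(p - 1) |Lin G|\<close>, which outweighs the linear characters.\<close>

section \<open>Linear characters of finite groups\<close>

text \<open>The constant comes from the dihedral group of order \<open>2 p\<close>: two linear
  characters and \<open>(p - 1) / 2\<close> characters of degree 2 have average degree
  \<open>2 (p + 1) / (p + 3)\<close>, so its weights sum to 0. An average says little about the
  average of a quotient, whereas a sum of weights in which only linear characters count negatively
  can be compared as soon as all linear characters are inflated from the quotient. A lower bound for
  the sum then needs only a sufficient supply of irreducible characters of known degree, since every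
  other nonlinear character contributes a nonnegative amount. The splitting creates this supply: a
  character \<open>l\<close> of \<open>N\<close> extends to its stabilizer as
  \<open>l (F g)\<close>, so induction produces a degree equal to the orbit size, and multiplication
  of the extension by linear characters of \<open>G\<close> produces further characters of the same
  degree. The cost is that different linear characters may give the same induced character; this
  accounts for the division by \<open>d\<close> in the count, which the factor \<open>d\<close> in
  the weight estimate makes up for.\<close>

definition lin_chars :: "('a, 'b) monoid_scheme \<Rightarrow> ('a \<Rightarrow> complex) set" where
  "lin_chars G = {\<mu> \<in> extensional (carrier G). \<mu> \<one>\<^bsub>G\<^esub> = 1 \<and>
     (\<forall>x\<in>carrier G. \<forall>y\<in>carrier G. \<mu> (x \<otimes>\<^bsub>G\<^esub> y) = \<mu> x * \<mu> y)}"

locale finite_group = group +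
  assumes fin: "finite (carrier G)"
begin

lemma lin_char_one: "\<mu> \<in> lin_chars G \<Longrightarrow> \<mu> \<one> = 1"
  by (simp add: lin_chars_def)

lemma lin_char_mult:
  "\<mu> \<in> lin_chars G \<Longrightarrow> x \<in> carrier G \<Longrightarrow> y \<in> carrier G \<Longrightarrow> \<mu> (x \<otimes> y) = \<mu> x * \<mu> y"
  by (simp add: lin_chars_def)

lemma lin_char_ext: "\<mu> \<in> lin_chars G \<Longrightarrow> \<mu> \<in> extensional (carrier G)"
  by (simp add: lin_chars_def)

lemma lin_char_inv_mult:
  assumes "\<mu> \<in> lin_chars G" "x \<in> carrier G"
  shows "\<mu> (inv x) * \<mu> x = 1"
  using assms lin_char_mult[of \<mu> "inv x" x] lin_char_one[of \<mu>] by simp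

lemma lin_char_nonzero: "\<mu> \<in> lin_chars G \<Longrightarrow> x \<in> carrier G \<Longrightarrow> \<mu> x \<noteq> 0"
  using lin_char_inv_mult[of \<mu> x] by auto

lemma lin_char_pow:
  "\<mu> \<in> lin_chars G \<Longrightarrow> x \<in> carrier G \<Longrightarrow> \<mu> (x [^] (n::nat)) = \<mu> x ^ n"
  by (induction n) (simp_all add: lin_char_one lin_char_mult)

lemma lin_char_root:
  assumes "\<mu> \<in> lin_chars G" "x \<in> carrier G"
  shows "\<mu> x ^ Coset.order G = 1"
  using lin_char_pow[OF assms, of "Coset.order G"] assms by (simp add: lin_char_one pow_order_eq_1)

lemma order_pos: "Coset.order G > 0"
  using fin by (simp add: order_gt_0_iff_finite)

lemma norm_lin_char:
  assumes "\<mu> \<in> lin_chars G" "x \<in> carrier G"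
  shows "cmod (\<mu> x) = 1"
  using lin_char_root[OF assms] order_pos
  by (metis norm_ge_zero norm_one norm_power power_eq_1_iff zero_less_iff_neq_zero)

lemma lin_char_cnj:
  assumes "\<mu> \<in> lin_chars G" "x \<in> carrier G"
  shows "\<mu> x * cnj (\<mu> x) = 1"
  using norm_lin_char[OF assms] by (simp add: complex_norm_square[symmetric])

lemma finite_lin_chars: "finite (lin_chars G)"
proof (rule finite_subset)
  show "lin_chars G \<subseteq> (\<Pi>\<^sub>E x\<in>carrier G. {z. z ^ Coset.order G = 1})"
    using lin_char_root lin_char_ext by (auto simp: PiE_def)
  show "finite (\<Pi>\<^sub>E x\<in>carrier G. {z::complex. z ^ Coset.order G = 1})"
    using fin order_pos by (intro finite_PiE finite_roots_unity) auto
qed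

lemma one_lin_char: "(\<lambda>x\<in>carrier G. 1) \<in> lin_chars G"
  by (simp add: lin_chars_def)

lemma lin_chars_eqI:
  assumes "\<mu> \<in> lin_chars G" "\<nu> \<in> lin_chars G" "\<And>x. x \<in> carrier G \<Longrightarrow> \<mu> x = \<nu> x"
  shows "\<mu> = \<nu>"
  using assms by (auto intro: extensionalityI simp: lin_chars_def)

lemma mult_lin_char:
  assumes "\<mu> \<in> lin_chars G" "\<nu> \<in> lin_chars G"
  shows "(\<lambda>x\<in>carrier G. \<mu> x * \<nu> x) \<in> lin_chars G"
  using assms by (auto simp: lin_chars_def)

lemma cnj_lin_char:
  assumes "\<mu> \<in> lin_chars G"
  shows "(\<lambda>x\<in>carrier G. cnj (\<mu> x)) \<in> lin_chars G"
  using assms by (auto simp: lin_chars_def)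

lemma sum_lin_char:
  assumes "\<mu> \<in> lin_chars G" "y \<in> carrier G" "\<mu> y \<noteq> 1"
  shows "(\<Sum>x\<in>carrier G. \<mu> x) = 0"
proof -
  have "bij_betw (\<lambda>x. y \<otimes> x) (carrier G) (carrier G)"
    using assms(2) by (intro bij_betwI[where g = "\<lambda>x. inv y \<otimes> x"]) (auto simp: m_assoc[symmetric])
  then have "(\<Sum>x\<in>carrier G. \<mu> x) = (\<Sum>x\<in>carrier G. \<mu> (y \<otimes> x))"
    by (intro sum.reindex_bij_betw[symmetric])
  also have "\<dots> = \<mu> y * (\<Sum>x\<in>carrier G. \<mu> x)"
    using assms by (simp add: lin_char_mult sum_distrib_left)
  finally show ?thesis
    using assms(3) by simp
qed

lemma lin_chars_orthogonal:
  assumes "\<mu> \<in> lin_chars G" "\<nu> \<in> lin_chars G"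
  shows "(\<Sum>x\<in>carrier G. \<mu> x * cnj (\<nu> x)) = (if \<mu> = \<nu> then of_nat (Coset.order G) else 0)"
proof (cases "\<mu> = \<nu>")
  case True
  then show ?thesis
    using assms by (simp add: lin_char_cnj Coset.order_def)
next
  case False
  then obtain y where y: "y \<in> carrier G" "\<mu> y \<noteq> \<nu> y"
    using lin_chars_eqI[OF assms] by blast
  let ?\<eta> = "\<lambda>x\<in>carrier G. \<mu> x * cnj (\<nu> x)"
  have "?\<eta> \<in> lin_chars G"
    using mult_lin_char[OF assms(1) cnj_lin_char[OF assms(2)]] by (simp add: restrict_def cong: if_cong)
  moreover have "?\<eta> y \<noteq> 1"
    using y lin_char_cnj[OF assms(2) y(1)] lin_char_nonzero[OF assms(2) y(1)]
    by auto (metis complex_cnj_zero_iff mult_cancel_right)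
  ultimately have "(\<Sum>x\<in>carrier G. ?\<eta> x) = 0"
    using sum_lin_char y(1) by blast
  then show ?thesis
    using False by simp
qed

text \<open>Pairing the relation with \<open>\<mu>\<close> isolates its coefficient. Applied to
  \<open>N\<close>, this lets the values of a character on \<open>N\<close> or on a coset of
  \<open>N\<close> determine its summands.\<close>

lemma lin_chars_independent:
  assumes "S \<subseteq> lin_chars G" "\<And>x. x \<in> carrier G \<Longrightarrow> (\<Sum>\<nu>\<in>S. c \<nu> * \<nu> x) = 0" "\<mu> \<in> S"
  shows "c \<mu> = 0"
proof -
  have finS: "finite S"
    using assms(1) finite_lin_chars finite_subset by blast
  have "0 = (\<Sum>x\<in>carrier G. (\<Sum>\<nu>\<in>S. c \<nu> * \<nu> x) * cnj (\<mu> x))"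
    using assms(2) by simp
  also have "\<dots> = (\<Sum>\<nu>\<in>S. c \<nu> * (\<Sum>x\<in>carrier G. \<nu> x * cnj (\<mu> x)))"
    by (subst sum_distrib_right, subst sum.swap) (simp add: sum_distrib_left mult.assoc)
  also have "\<dots> = (\<Sum>\<nu>\<in>S. c \<nu> * (if \<nu> = \<mu> then of_nat (Coset.order G) else 0))"
    using assms by (intro sum.cong refl arg_cong2[of _ _ _ _ "(*)"] lin_chars_orthogonal) auto
  also have "\<dots> = c \<mu> * of_nat (Coset.order G)"
    using finS assms(3) by (simp add: if_distrib cong: if_cong)
  finally show ?thesis
    using order_pos by simp
qed

text \<open>The sum \<open>s\<close> of the characters in \<open>S\<close> satisfies \<open>\<Sum>\<^sub>G |s|\<^sup>2 = card S * |G|\<close>, while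
  \<open>|s| = card S\<close> on \<open>T\<close>.\<close>

lemma card_lin_chars_agreeing:
  assumes "S \<subseteq> lin_chars G" "T \<subseteq> carrier G"
    and agree: "\<And>\<mu> \<nu> x. \<mu> \<in> S \<Longrightarrow> \<nu> \<in> S \<Longrightarrow> x \<in> T \<Longrightarrow> \<mu> x = \<nu> x"
  shows "card S * card T \<le> Coset.order G"
proof (cases "S = {}")
  case False
  then obtain \<nu> where \<nu>: "\<nu> \<in> S" by blast
  have finS: "finite S"
    using assms(1) finite_lin_chars finite_subset by blast
  define s where "s x = (\<Sum>\<mu>\<in>S. \<mu> x)" for x
  have "of_real (\<Sum>x\<in>carrier G. (cmod (s x))\<^sup>2) = (\<Sum>x\<in>carrier G. s x * cnj (s x))"
    by (simp only: of_real_sum complex_norm_square)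
  also have "\<dots> = (\<Sum>x\<in>carrier G. \<Sum>\<mu>\<in>S. \<Sum>\<eta>\<in>S. \<mu> x * cnj (\<eta> x))"
    by (simp add: s_def sum_product)
  also have "\<dots> = (\<Sum>\<mu>\<in>S. \<Sum>\<eta>\<in>S. \<Sum>x\<in>carrier G. \<mu> x * cnj (\<eta> x))"
    by (subst sum.swap, rule sum.cong[OF refl], rule sum.swap)
  also have "\<dots> = (\<Sum>\<mu>\<in>S. \<Sum>\<eta>\<in>S. if \<mu> = \<eta> then of_nat (Coset.order G) else 0)"
    using assms(1) by (intro sum.cong refl lin_chars_orthogonal) auto
  also have "\<dots> = of_real (real (card S * Coset.order G))"
    using finS by simp
  finally have total: "(\<Sum>x\<in>carrier G. (cmod (s x))\<^sup>2) = real (card S * Coset.order G)"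
    using of_real_eq_iff by blast
  have "cmod (s x) = real (card S)" if "x \<in> T" for x
  proof -
    have "s x = (\<Sum>\<mu>\<in>S. \<nu> x)"
      unfolding s_def using agree \<nu> that by (intro sum.cong) auto
    then show ?thesis
      using that assms \<nu> by (auto simp: norm_mult norm_lin_char subset_eq)
  qed
  then have "real (card S)^2 * real (card T) = (\<Sum>x\<in>T. (cmod (s x))\<^sup>2)"
    by simp
  also have "\<dots> \<le> real (card S * Coset.order G)"
    unfolding total[symmetric] using assms(2) fin by (intro sum_mono2) auto
  finally have "real (card S) * (real (card S) * real (card T)) \<le> real (card S) * real (Coset.order G)"
    by (simp add: power2_eq_square)
  moreover have "real (card S) > 0"
    using finS \<nu> by (auto simp: card_gt_0_iff)
  ultimately have "real (card S * card T) \<le> real (Coset.order G)"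
    by simp
  then show ?thesis
    by linarith
qed simp

end

section \<open>Crossed homomorphisms and coprime extensions\<close>

locale abelian_normal = finite_group G + normal N G for N and G (structure) +
  assumes abelian: "x \<in> N \<Longrightarrow> y \<in> N \<Longrightarrow> x \<otimes> y = y \<otimes> x"
begin

abbreviation NN where "NN \<equiv> G\<lparr>carrier := N\<rparr>"

lemma N_closed [simp]: "x \<in> N \<Longrightarrow> x \<in> carrier G"
  by (rule mem_carrier)

lemma finN: "finite N"
  using fin subset finite_subset by blast

sublocale N: comm_group NN
  rewrites "carrier NN = N" and "monoid.mult NN = monoid.mult G" and "monoid.one NN = \<one>"
  by (rule group.group_comm_groupI[OF subgroup.subgroup_is_group[OF is_subgroup group_axioms]])
    (auto simp: abelian)

lemma N_pow [simp]: "x [^]\<^bsub>NN\<^esub> (n::nat) = x [^] n"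
  by (rule nat_pow_consistent[symmetric])

definition conj :: "'a \<Rightarrow> 'a \<Rightarrow> 'a" where
  "conj g x = g \<otimes> x \<otimes> inv g"

lemma conj_closed [simp]: "g \<in> carrier G \<Longrightarrow> x \<in> carrier G \<Longrightarrow> conj g x \<in> carrier G"
  by (simp add: conj_def)

lemma conj_N [simp]: "g \<in> carrier G \<Longrightarrow> x \<in> N \<Longrightarrow> conj g x \<in> N"
  by (simp add: conj_def inv_op_closed2)

lemma inv_mult_cancel [simp]:
  assumes "x \<in> carrier G" "y \<in> carrier G"
  shows "inv x \<otimes> (x \<otimes> y) = y" "x \<otimes> (inv x \<otimes> y) = y"
  using assms by (simp_all add: m_assoc[symmetric])

lemma conj_mult:
  "g \<in> carrier G \<Longrightarrow> x \<in> carrier G \<Longrightarrow> y \<in> carrier G \<Longrightarrow> conj g (x \<otimes> y) = conj g x \<otimes> conj g y"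
  by (simp add: conj_def m_assoc)

lemma conj_conj:
  "g \<in> carrier G \<Longrightarrow> h \<in> carrier G \<Longrightarrow> x \<in> carrier G \<Longrightarrow> conj g (conj h x) = conj (g \<otimes> h) x"
  unfolding conj_def by (simp add: inv_mult_group m_assoc)

lemma conj_by_one [simp]: "x \<in> carrier G \<Longrightarrow> conj \<one> x = x"
  by (simp add: conj_def)

lemma conj_one [simp]: "g \<in> carrier G \<Longrightarrow> conj g \<one> = \<one>"
  by (simp add: conj_def)

lemma conj_inv: "g \<in> carrier G \<Longrightarrow> x \<in> carrier G \<Longrightarrow> conj g (inv x) = inv (conj g x)"
  by (simp add: conj_def inv_mult_group m_assoc)

lemma conj_N_trivial: "n \<in> N \<Longrightarrow> x \<in> N \<Longrightarrow> conj n x = x"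
  by (simp add: conj_def abelian[of n x] m_assoc)

lemma conj_pow:
  "g \<in> carrier G \<Longrightarrow> x \<in> carrier G \<Longrightarrow> conj g (x [^] (n::nat)) = conj g x [^] n"
  by (induction n) (simp_all add: conj_mult)

lemma N_pow_closed [simp]: "x \<in> N \<Longrightarrow> x [^] (n::nat) \<in> N"
  using N.nat_pow_closed by simp

lemma N_pow_mult: "x \<in> N \<Longrightarrow> y \<in> N \<Longrightarrow> (x \<otimes> y) [^] (n::nat) = x [^] n \<otimes> y [^] n"
  using N.nat_pow_distrib by simp

lemma conj_finprod:
  assumes "g \<in> carrier G" "u \<in> A \<rightarrow> N"
  shows "conj g (finprod NN u A) = finprod NN (\<lambda>r. conj g (u r)) A"
  using assms(2)
proof (induction A rule: infinite_finite_induct)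
  case (insert r A)
  then have "finprod NN u A \<in> N" "u r \<in> N"
    using N.finprod_closed by auto
  with insert show ?case
    using assms(1) by (subst (1 2) N.finprod_insert) (auto simp: conj_mult Pi_def)
qed (use assms in simp_all)

text \<open>A 1-cocycle with values in \<open>N\<close>. When it is the identity on
  \<open>N\<close>, its kernel is a complement of \<open>N\<close> in \<open>H\<close>, and each
  \<open>x\<close> is \<open>f x\<close> times an element of the kernel. In this form the comparison
  of two complements becomes a computation inside the abelian group \<open>N\<close>.\<close>

definition crossed_hom :: "'a set \<Rightarrow> ('a \<Rightarrow> 'a) \<Rightarrow> bool" where
  "crossed_hom H f \<longleftrightarrow> f \<in> H \<rightarrow> N \<and> (\<forall>x\<in>H. \<forall>y\<in>H. f (x \<otimes> y) = f x \<otimes> conj x (f y))"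

lemma crossed_hom_closed: "crossed_hom H f \<Longrightarrow> x \<in> H \<Longrightarrow> f x \<in> N"
  by (auto simp: crossed_hom_def)

lemma crossed_hom_mult:
  "crossed_hom H f \<Longrightarrow> x \<in> H \<Longrightarrow> y \<in> H \<Longrightarrow> f (x \<otimes> y) = f x \<otimes> conj x (f y)"
  by (auto simp: crossed_hom_def)

end

text \<open>In the application \<open>H / N\<close>, of order \<open>m\<close>, is the normal
  \<open>p\<close>-complement of \<open>G / N\<close>.\<close>

locale coprime_extension = abelian_normal N G + H: normal H G for N H and G (structure) +
  fixes p m :: nat
  assumes N_le_H: "N \<subseteq> H"
    and card_H: "card H = m * card N"
    and coprime_m: "coprime m p"
    and exponent: "x \<in> N \<Longrightarrow> x [^] p = \<one>"
begin

lemma H_closed [simp]: "x \<in> H \<Longrightarrow> x \<in> carrier G"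
  by (rule H.mem_carrier)

lemma N_in_H [simp]: "x \<in> N \<Longrightarrow> x \<in> H"
  using N_le_H by auto

lemma conj_H [simp]: "g \<in> carrier G \<Longrightarrow> x \<in> H \<Longrightarrow> conj g x \<in> H"
  by (simp add: conj_def H.inv_op_closed2)

section \<open>Coset representatives of N in H\<close>

definition rep :: "'a \<Rightarrow> 'a" where
  "rep x = (SOME y. y \<in> N #> x)"

definition transversal :: "'a set" where
  "transversal = rep ` H"

lemma rep_in: "x \<in> carrier G \<Longrightarrow> rep x \<in> N #> x"
  unfolding rep_def by (rule someI[of _ x]) (rule rcos_self[OF _ is_subgroup])

lemma rep_coset: "x \<in> carrier G \<Longrightarrow> N #> rep x = N #> x"
  using repr_independence[OF rep_in _ is_subgroup] by simp

lemma rep_cong: "N #> x = N #> y \<Longrightarrow> rep x = rep y"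
  by (simp add: rep_def)

lemma rep_closed: 
  assumes "x \<in> H" shows "rep x \<in> H"
  using rep_in[of x] assms H.m_closed N_le_H unfolding r_coset_def by auto

lemma rep_N_mult:
  assumes "n \<in> N" "x \<in> carrier G"
  shows "rep (n \<otimes> x) = rep x"
  using assms coset_mult_assoc[of N n x] rcos_const[OF is_group assms(1)] subset
  by (intro rep_cong) simp

lemma rep_quotient:
  assumes "x \<in> carrier G"
  shows "x \<otimes> inv (rep x) \<in> N"
proof -
  obtain n where n: "n \<in> N" "rep x = n \<otimes> x"
    using rep_in[OF assms] unfolding r_coset_def by auto
  then have "x \<otimes> inv (rep x) = inv n"
    using assms by (simp add: inv_mult_group m_assoc[symmetric])
  then show ?thesis
    using n by simp
qed

lemma transversal_H: "r \<in> transversal \<Longrightarrow> r \<in> H"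
  unfolding transversal_def using rep_closed by auto

lemma rep_transversal: "r \<in> transversal \<Longrightarrow> rep r = r"
  unfolding transversal_def using rep_cong[OF rep_coset] H_closed by blast

lemma rep_in_transversal: "x \<in> H \<Longrightarrow> rep x \<in> transversal"
  unfolding transversal_def by auto

lemma card_transversal: "card transversal = m"
proof -
  have "bij_betw (\<lambda>(n, r). n \<otimes> r) (N \<times> transversal) H"
  proof (rule bij_betwI[where g = "\<lambda>x. (x \<otimes> inv (rep x), rep x)"])
    show "(\<lambda>(n, r). n \<otimes> r) \<in> N \<times> transversal \<rightarrow> H"
      using transversal_H by auto
    show "(\<lambda>x. (x \<otimes> inv (rep x), rep x)) \<in> H \<rightarrow> N \<times> transversal"
      using rep_quotient rep_in_transversal by auto
    show "(\<lambda>x. (x \<otimes> inv (rep x), rep x)) ((\<lambda>(n, r). n \<otimes> r) z) = z" if "z \<in> N \<times> transversal" for z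
      using that by (auto simp: rep_N_mult rep_transversal transversal_H m_assoc)
    show "(\<lambda>(n, r). n \<otimes> r) ((\<lambda>x. (x \<otimes> inv (rep x), rep x)) x) = x" if "x \<in> H" for x
      using that rep_closed by (simp add: m_assoc)
  qed
  then have "card N * card transversal = m * card N"
    using bij_betw_same_card card_cartesian_product card_H by metis
  moreover have "card N > 0"
    using finN by (auto simp: card_gt_0_iff)
  ultimately show ?thesis
    by simp
qed

text \<open>As \<open>N\<close> is normal, left multiplication permutes its cosets; this is that
  permutation read off on representatives, with left multiplication by \<open>inv x\<close> as
  inverse.\<close>

lemma transversal_bij:
  assumes "x \<in> H"
  shows "bij_betw (\<lambda>r. rep (x \<otimes> r)) transversal transversal"
proof -
  have cancel: "rep (inv y \<otimes> rep (y \<otimes> r)) = r" if "r \<in> transversal" "y \<in> H" for y r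
  proof -
    let ?n = "y \<otimes> r \<otimes> inv (rep (y \<otimes> r))"
    have c: "y \<in> carrier G" "r \<in> carrier G" "rep (y \<otimes> r) \<in> carrier G"
      using that transversal_H rep_closed by simp_all
    then have n: "?n \<in> N"
      using rep_quotient by simp
    have "inv y \<otimes> rep (y \<otimes> r) = conj (inv y) (inv ?n) \<otimes> r"
      using c by (simp add: conj_def inv_mult_group m_assoc)
    then show ?thesis
      using n c that by (simp add: rep_N_mult rep_transversal del: m_closed)
  qed
  show ?thesis
  proof (rule bij_betwI[where g = "\<lambda>r. rep (inv x \<otimes> r)"])
    show "(\<lambda>r. rep (x \<otimes> r)) \<in> transversal \<rightarrow> transversal"
      "(\<lambda>r. rep (inv x \<otimes> r)) \<in> transversal \<rightarrow> transversal"
      using assms transversal_H rep_in_transversal by auto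
  qed (use cancel[of _ x] cancel[of _ "inv x"] assms in auto)
qed

section \<open>Averaging over cosets: complements in H exist and are conjugate\<close>

definition root :: nat where
  "root = (SOME k. [m * k = 1] (mod p))"

lemma pow_m_root:
  assumes "x \<in> N"
  shows "(x [^] m) [^] root = x"
proof -
  have "[m * root = 1] (mod p)"
    unfolding root_def by (rule someI_ex) (use cong_solve_coprime_nat[OF coprime_m] in simp)
  then obtain q1 q2 where "1 + q2 * p = m * root + q1 * p"
    unfolding cong_iff_lin_nat by blast
  then have q: "m * root + p * q1 = 1 + p * q2"
    by (simp add: mult.commute)
  have "x [^] (m * root + p * q1) = x [^] (m * root)"
    using assms by (simp add: nat_pow_mult[symmetric] nat_pow_pow[symmetric] exponent)
  moreover have "x [^] (1 + p * q2) = x"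
    using assms by (simp add: nat_pow_mult[symmetric] nat_pow_pow[symmetric] exponent del: One_nat_def)
  ultimately show ?thesis
    using q assms by (simp add: nat_pow_pow)
qed

text \<open>Each factor measures how far left multiplication by \<open>x\<close> is from permuting
  the representatives.\<close>

definition transfer :: "'a \<Rightarrow> 'a" where
  "transfer x = finprod NN (\<lambda>r. x \<otimes> r \<otimes> inv (rep (x \<otimes> r))) transversal"

lemma transfer_closed:
  assumes "x \<in> H"
  shows "transfer x \<in> N"
  unfolding transfer_def using assms transversal_H rep_quotient
  by (intro N.finprod_closed) auto

text \<open>The law holds factor by factor, except that the factor of \<open>x\<close> appears at
  \<open>rep (y \<otimes> r)\<close> instead of \<open>r\<close>; the product over the whole
  transversal absorbs this permutation.\<close>

lemma transfer_mult:
  assumes "x \<in> H" "y \<in> H"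
  shows "transfer (x \<otimes> y) = transfer x \<otimes> conj x (transfer y)"
proof -
  let ?u = "\<lambda>x r. x \<otimes> r \<otimes> inv (rep (x \<otimes> r))"
  have u: "?u z \<in> transversal \<rightarrow> N" if "z \<in> H" for z
    using that transversal_H rep_quotient by auto
  have step: "?u (x \<otimes> y) r = conj x (?u y r) \<otimes> ?u x (rep (y \<otimes> r))" if r: "r \<in> transversal" for r
  proof -
    have c: "x \<in> carrier G" "y \<in> carrier G" "r \<in> carrier G" "rep (y \<otimes> r) \<in> carrier G"
      using that assms transversal_H rep_closed by simp_all
    have n: "?u y r \<in> N"
      using u[OF assms(2)] r by auto
    have eq: "x \<otimes> y \<otimes> r = conj x (?u y r) \<otimes> (x \<otimes> rep (y \<otimes> r))"
      using c by (simp add: conj_def m_assoc)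
    then have "rep (x \<otimes> y \<otimes> r) = rep (x \<otimes> rep (y \<otimes> r))"
      using n c by (simp add: rep_N_mult)
    moreover have "rep (x \<otimes> rep (y \<otimes> r)) \<in> carrier G"
      using assms r transversal_H rep_closed by simp
    ultimately show ?thesis
      using c eq n by (simp add: m_assoc)
  qed
  have "transfer (x \<otimes> y) = finprod NN (\<lambda>r. conj x (?u y r) \<otimes> ?u x (rep (y \<otimes> r))) transversal"
    unfolding transfer_def using assms u step
    by (intro N.finprod_cong') (auto simp: Pi_def rep_in_transversal transversal_H)
  also have "\<dots> = finprod NN (\<lambda>r. conj x (?u y r)) transversal \<otimes>
      finprod NN (\<lambda>r. ?u x (rep (y \<otimes> r))) transversal"
    using assms u by (intro N.finprod_multf) (auto simp: Pi_def rep_in_transversal transversal_H)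
  also have "finprod NN (\<lambda>r. conj x (?u y r)) transversal = conj x (transfer y)"
    unfolding transfer_def using assms u by (subst conj_finprod) auto
  also have "finprod NN (\<lambda>r. ?u x (rep (y \<otimes> r))) transversal = transfer x"
    unfolding transfer_def
    using N.finprod_reindex[of "?u x" "\<lambda>r. rep (y \<otimes> r)" transversal]
      transversal_bij[OF assms(2)] u[OF assms(1)] by (simp add: bij_betw_def)
  finally show ?thesis
    using assms transfer_closed abelian by simp
qed

lemma transfer_N:
  assumes "n \<in> N"
  shows "transfer n = n [^] m"
proof -
  have "transfer n = finprod NN (\<lambda>r. n) transversal"
    unfolding transfer_def using assms transversal_H
    by (intro N.finprod_cong') (auto simp: rep_N_mult rep_transversal m_assoc)
  also have "\<dots> = n [^] m"
    using N.finprod_const[of n transversal] assms card_transversal by simp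
  finally show ?thesis .
qed

text \<open>The existence half of Schur-Zassenhaus. The transfer restricts to the
  \<open>m\<close>-th power on \<open>N\<close>, and raising to \<open>root\<close> undoes that
  power because \<open>N\<close> has exponent \<open>p\<close>. It preserves the cocycle law since
  powers commute with products in \<open>N\<close> and with conjugation.\<close>

lemma crossed_hom_H_exists: "\<exists>f. crossed_hom H f \<and> (\<forall>n\<in>N. f n = n)"
proof (intro exI conjI ballI)
  show "crossed_hom H (\<lambda>x. transfer x [^] root)"
    unfolding crossed_hom_def
    by (auto simp: transfer_closed transfer_mult N_pow_mult conj_pow)
  show "transfer n [^] root = n" if "n \<in> N" for n
    using that by (simp add: transfer_N pow_m_root)
qed

text \<open>Vanishing of the first cohomology: \<open>e\<close> is constant on cosets of
  \<open>N\<close>, so it can be multiplied over the transversal, which exhibits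
  \<open>e x [^] m\<close> as the coboundary of the product \<open>a\<close>.\<close>

lemma crossed_hom_principal:
  assumes "crossed_hom H e" "\<And>n. n \<in> N \<Longrightarrow> e n = \<one>"
  shows "\<exists>b\<in>N. \<forall>x\<in>H. e x = b \<otimes> inv (conj x b)"
proof -
  note e_closed = crossed_hom_closed[OF assms(1)]
  define a where "a = finprod NN e transversal"
  have e_rep: "e (rep x) = e x" if "x \<in> H" for x
  proof -
    have n: "x \<otimes> inv (rep x) \<in> N" and r: "rep x \<in> H"
      using that rep_quotient rep_closed by auto
    have "e x = e ((x \<otimes> inv (rep x)) \<otimes> rep x)"
      using that r by (simp add: m_assoc)
    also have "\<dots> = e (rep x)"
      using crossed_hom_mult[OF assms(1) N_in_H[OF n] r] assms(2)[OF n] e_closed[OF r] n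
      by (simp add: conj_N_trivial)
    finally show ?thesis ..
  qed
  have a: "a \<in> N"
    unfolding a_def using e_closed transversal_H by (intro N.finprod_closed) auto
  show ?thesis
  proof (intro bexI ballI)
    show "a [^] root \<in> N"
      using a by simp
    fix x assume x: "x \<in> H"
    \<comment> \<open>Left multiplication by \<open>x\<close> permutes the transversal, so the
      product may run over the shifted representatives.\<close>
    have "a = finprod NN (\<lambda>r. e (rep (x \<otimes> r))) transversal"
      unfolding a_def using N.finprod_reindex[of e "\<lambda>r. rep (x \<otimes> r)" transversal]
        transversal_bij[OF x] e_closed transversal_H by (simp add: bij_betw_def Pi_def)
    also have "\<dots> = finprod NN (\<lambda>r. e x \<otimes> conj x (e r)) transversal"
      using x transversal_H e_closed e_rep crossed_hom_mult[OF assms(1)]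
      by (intro N.finprod_cong') (auto simp: Pi_def)
    also have "\<dots> = e x [^] m \<otimes> conj x a"
      unfolding a_def using x transversal_H e_closed N.finprod_const[of "e x" transversal]
      by (subst N.finprod_multf) (auto simp: Pi_def conj_finprod card_transversal)
    finally have "a \<otimes> inv (conj x a) = e x [^] m \<otimes> conj x a \<otimes> inv (conj x a)"
      by (rule arg_cong)
    then have "e x [^] m = a \<otimes> inv (conj x a)"
      using x a e_closed by (simp add: m_assoc)
    then have "(e x [^] m) [^] root = a [^] root \<otimes> inv (conj x a) [^] root"
      using x a by (simp add: N_pow_mult)
    then show "e x = a [^] root \<otimes> inv (conj x (a [^] root))"
      using x a e_closed by (simp add: pow_m_root nat_pow_inv conj_pow)
  qed
qed

section \<open>Conjugate complements and extension to G\<close>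

lemma crossed_hom_conj:
  assumes "crossed_hom H f" "g \<in> carrier G"
  shows "crossed_hom H (\<lambda>x. conj g (f (conj (inv g) x)))"
  using assms
  by (auto simp: crossed_hom_def conj_mult conj_conj Pi_def m_assoc[symmetric] intro!: arg_cong2[of _ _ _ _ "(\<otimes>)"])
    (simp_all add: conj_def m_assoc inv_mult_group)

text \<open>The quotient of the two maps is a crossed homomorphism that is trivial on
  \<open>N\<close>, hence principal. For maps that are the identity on \<open>N\<close> this says
  that complements are conjugate under \<open>N\<close>.\<close>

lemma crossed_hom_unique:
  assumes "crossed_hom H f" "crossed_hom H f'" "\<And>n. n \<in> N \<Longrightarrow> f n = f' n"
  shows "\<exists>b\<in>N. \<forall>x\<in>H. f' x = f x \<otimes> (inv b \<otimes> conj x b)"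
proof -
  note cl = crossed_hom_closed[OF assms(1)] crossed_hom_closed[OF assms(2)]
  have crossed: "crossed_hom H (\<lambda>x. f x \<otimes> inv (f' x))"
    unfolding crossed_hom_def
  proof (intro conjI ballI)
    show "(\<lambda>x. f x \<otimes> inv (f' x)) \<in> H \<rightarrow> N"
      using cl by auto
    fix x y assume x: "x \<in> H" and y: "y \<in> H"
    have 1: "inv (f' x \<otimes> conj x (f' y)) = inv (f' x) \<otimes> inv (conj x (f' y))"
      using cl x y by (simp add: inv_mult_group abelian)
    have 2: "conj x (f y) \<otimes> (inv (f' x) \<otimes> inv (conj x (f' y))) =
        inv (f' x) \<otimes> (conj x (f y) \<otimes> inv (conj x (f' y)))"
      using cl x y N.m_lcomm[of "conj x (f y)" "inv (f' x)" "inv (conj x (f' y))"] by simp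
    show "f (x \<otimes> y) \<otimes> inv (f' (x \<otimes> y)) = f x \<otimes> inv (f' x) \<otimes> conj x (f y \<otimes> inv (f' y))"
      using cl x y by (simp add: crossed_hom_mult[OF assms(1)] crossed_hom_mult[OF assms(2)]
          conj_mult conj_inv 1 2 m_assoc)
  qed
  have trivial: "f n \<otimes> inv (f' n) = \<one>" if "n \<in> N" for n
    using that assms(3) cl by simp
  obtain b where b: "b \<in> N" "\<And>x. x \<in> H \<Longrightarrow> f x \<otimes> inv (f' x) = b \<otimes> inv (conj x b)"
    using crossed_hom_principal[OF crossed trivial] by blast
  have "f' x = f x \<otimes> (inv b \<otimes> conj x b)" if x: "x \<in> H" for x
  proof -
    have c: "f x \<in> N" "f' x \<in> N" "b \<in> N" "conj x b \<in> N"
      using x b cl by auto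
    have fx: "f x = b \<otimes> inv (conj x b) \<otimes> f' x"
      using c by (simp add: b(2)[OF x, symmetric] m_assoc)
    have "f x \<otimes> (inv b \<otimes> conj x b) = b \<otimes> inv (conj x b) \<otimes> f' x \<otimes> (conj x b \<otimes> inv b)"
      using c abelian[of "inv b" "conj x b"] fx by simp
    also have "\<dots> = f' x \<otimes> (b \<otimes> inv (conj x b) \<otimes> (conj x b \<otimes> inv b))"
      using c abelian[of "b \<otimes> inv (conj x b)" "f' x"] by (simp add: m_assoc)
    also have "\<dots> = f' x"
      using c by (simp add: m_assoc)
    finally show ?thesis ..
  qed
  then show ?thesis
    using b(1) by blast
qed

text \<open>The twisted map is again the identity on \<open>N\<close>; its kernel is the conjugate
  by \<open>g\<close> of the kernel of \<open>f\<close>.\<close>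

lemma crossed_hom_conj_unique:
  assumes "crossed_hom H f" "\<And>n. n \<in> N \<Longrightarrow> f n = n" "g \<in> carrier G"
  shows "\<exists>b\<in>N. \<forall>x\<in>H. conj g (f (conj (inv g) x)) = f x \<otimes> (inv b \<otimes> conj x b)"
proof (rule crossed_hom_unique[OF assms(1) crossed_hom_conj[OF assms(1,3)]])
  show "f n = conj g (f (conj (inv g) n))" if "n \<in> N" for n
    using that assms(2,3) by (simp add: conj_conj)
qed

text \<open>A Frattini argument in cocycle form. Each conjugate of the complement in
  \<open>H\<close> arises from it through an element of \<open>N\<close>, and the absence of fixed
  points makes this element unique. Taking it as \<open>F g\<close> gives a cocycle on
  \<open>G\<close> whose kernel is the normalizer of the kernel of \<open>f\<close>.\<close>

lemma crossed_hom_extends: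
  assumes fixfree: "\<And>b. b \<in> N \<Longrightarrow> (\<And>x. x \<in> H \<Longrightarrow> conj x b = b) \<Longrightarrow> b = \<one>"
  shows "\<exists>F. crossed_hom (carrier G) F \<and> (\<forall>n\<in>N. F n = n)"
proof -
  obtain f where f: "crossed_hom H f" "\<And>n. n \<in> N \<Longrightarrow> f n = n"
    using crossed_hom_H_exists by blast
  note f_closed = crossed_hom_closed[OF f(1)]
  define tw where "tw g x = conj g (f (conj (inv g) x))" for g x
  have "\<forall>g\<in>carrier G. \<exists>b. b \<in> N \<and> (\<forall>x\<in>H. tw g x = f x \<otimes> (inv b \<otimes> conj x b))"
    unfolding tw_def using crossed_hom_conj_unique[OF f] by blast
  then obtain F where F: "\<And>g. g \<in> carrier G \<Longrightarrow> F g \<in> N"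
    "\<And>g x. g \<in> carrier G \<Longrightarrow> x \<in> H \<Longrightarrow> tw g x = f x \<otimes> (inv (F g) \<otimes> conj x (F g))"
    using bchoice[of "carrier G" "\<lambda>g b. b \<in> N \<and> (\<forall>x\<in>H. tw g x = f x \<otimes> (inv b \<otimes> conj x b))"] by blast
  \<comment> \<open>Two candidates for \<open>F g\<close> differ by an element of \<open>N\<close>
    that \<open>H\<close> fixes.\<close>
  have F_eqI: "F g = b" if "g \<in> carrier G" "b \<in> N"
    and tw_b: "\<And>x. x \<in> H \<Longrightarrow> tw g x = f x \<otimes> (inv b \<otimes> conj x b)" for g b
  proof -
    let ?a = "F g"
    have a: "?a \<in> N"
      using F(1) that(1) .
    have "conj x (?a \<otimes> inv b) = ?a \<otimes> inv b" if x: "x \<in> H" for x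
    proof -
      have "f x \<otimes> (inv ?a \<otimes> conj x ?a) = f x \<otimes> (inv b \<otimes> conj x b)"
        using F(2)[OF \<open>g \<in> carrier G\<close> x] tw_b[OF x] by simp
      then have eq: "inv ?a \<otimes> conj x ?a = inv b \<otimes> conj x b"
        using a \<open>b \<in> N\<close> x f_closed[OF x] by simp
      have "conj x ?a = ?a \<otimes> (inv ?a \<otimes> conj x ?a)"
        using a x by simp
      also have "\<dots> = ?a \<otimes> inv b \<otimes> conj x b"
        using a \<open>b \<in> N\<close> x unfolding eq by (simp add: m_assoc)
      finally have "conj x ?a \<otimes> inv (conj x b) = ?a \<otimes> inv b \<otimes> conj x b \<otimes> inv (conj x b)"
        by (rule arg_cong)
      then show ?thesis
        using a \<open>b \<in> N\<close> x by (simp add: conj_mult conj_inv m_assoc)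
    qed
    then have "?a \<otimes> inv b = \<one>"
      using fixfree[of "?a \<otimes> inv b"] a \<open>b \<in> N\<close> by simp
    then have "?a \<otimes> inv b \<otimes> b = b"
      using \<open>b \<in> N\<close> by simp
    then show ?thesis
      using a \<open>b \<in> N\<close> by (simp add: m_assoc)
  qed
  \<comment> \<open>Conjugation by \<open>inv n\<close> multiplies \<open>x\<close> by the
    commutator \<open>?k\<close>, which lies in \<open>N\<close>, where \<open>f\<close> is the
    identity.\<close>
  have "F n = n" if n: "n \<in> N" for n
  proof (rule F_eqI)
    fix x assume x: "x \<in> H"
    let ?k = "inv n \<otimes> conj x n"
    have k: "?k \<in> N"
      using n x by simp
    have "conj (inv n) x = ?k \<otimes> x"
      using n x by (simp add: conj_def m_assoc)
    then have "f (conj (inv n) x) = ?k \<otimes> f x"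
      using crossed_hom_mult[OF f(1) N_in_H[OF k] x] f(2)[OF k] k f_closed[OF x]
      by (simp add: conj_N_trivial)
    then show "tw n x = f x \<otimes> ?k"
      unfolding tw_def using n k f_closed[OF x] abelian[OF f_closed[OF x] k]
      by (simp add: conj_N_trivial)
  qed (use n in simp_all)
  moreover have "F (g \<otimes> h) = F g \<otimes> conj g (F h)" if g: "g \<in> carrier G" and h: "h \<in> carrier G" for g h
  proof (rule F_eqI)
    fix x assume x: "x \<in> H"
    let ?y = "conj (inv g) x"
    have y: "?y \<in> H"
      using g x by simp
    have c: "F g \<in> N" "F h \<in> N" "f x \<in> N" "f ?y \<in> N"
      using F(1) g h x y f_closed by auto
    \<comment> \<open>The twist by a product is an iterated twist; expanding the inner one at
      \<open>?y\<close> leaves the coboundary of \<open>F g \<otimes> conj g (F h)\<close>.\<close>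
    have "tw (g \<otimes> h) x = conj g (tw h ?y)"
      unfolding tw_def using g h x f_closed y by (simp add: conj_conj inv_mult_group)
    also have "\<dots> = conj g (f ?y \<otimes> (inv (F h) \<otimes> conj ?y (F h)))"
      using F(2)[OF h y] by simp
    also have "\<dots> = tw g x \<otimes> (inv (conj g (F h)) \<otimes> conj g (conj ?y (F h)))"
      unfolding tw_def using g c y by (simp add: conj_mult conj_inv)
    also have "conj g (conj ?y (F h)) = conj x (conj g (F h))"
      using g x c y by (simp add: conj_conj) (simp add: conj_def m_assoc)
    also have "tw g x = f x \<otimes> (inv (F g) \<otimes> conj x (F g))"
      using F(2)[OF g x] .
    finally have "tw (g \<otimes> h) x = f x \<otimes> (inv (F g) \<otimes> conj x (F g)) \<otimes>
        (inv (conj g (F h)) \<otimes> conj x (conj g (F h)))" .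
    moreover have "inv (F g \<otimes> conj g (F h)) = inv (F g) \<otimes> inv (conj g (F h))"
      using g c by (simp add: inv_mult_group abelian)
    moreover have "conj x (F g) \<otimes> (inv (conj g (F h)) \<otimes> conj x (conj g (F h))) =
        inv (conj g (F h)) \<otimes> (conj x (F g) \<otimes> conj x (conj g (F h)))"
      using g x c N.m_lcomm[of "conj x (F g)" "inv (conj g (F h))" "conj x (conj g (F h))"] by simp
    ultimately show "tw (g \<otimes> h) x = f x \<otimes> (inv (F g \<otimes> conj g (F h)) \<otimes> conj x (F g \<otimes> conj g (F h)))"
      using g h x c by (simp add: conj_mult m_assoc)
  qed (use g h F in simp_all)
  ultimately show ?thesis
    using F(1) unfolding crossed_hom_def by blast
qed

text \<open>Under a trivial action of \<open>H\<close> a crossed homomorphism is a homomorphism and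
  coboundaries vanish. So \<open>f\<close> equals all its conjugates, and its kernel is normal in
  \<open>G\<close>, not only in \<open>H\<close>.\<close>

lemma central_complement:
  assumes central: "\<And>b x. b \<in> N \<Longrightarrow> x \<in> H \<Longrightarrow> conj x b = b"
  shows "\<exists>K. K \<lhd> G \<and> card K = m"
proof -
  obtain f where f: "crossed_hom H f" "\<And>n. n \<in> N \<Longrightarrow> f n = n"
    using crossed_hom_H_exists by blast
  note f_closed = crossed_hom_closed[OF f(1)]
  have f_mult: "f (x \<otimes> y) = f x \<otimes> f y" if "x \<in> H" "y \<in> H" for x y
    using that f_closed central crossed_hom_mult[OF f(1)] by simp
  have f_conj: "conj g (f (conj (inv g) x)) = f x" if "g \<in> carrier G" "x \<in> H" for g x
    using crossed_hom_conj_unique[OF f that(1)] that(2) f_closed central by force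
  define K where "K = {x \<in> H. f x = \<one>}"
  have f_one: "f \<one> = \<one>"
    using f(2) by simp
  have f_inv: "f (inv x) = \<one>" if "x \<in> H" "f x = \<one>" for x
    using f_mult[of x "inv x"] that f_one f_closed[of "inv x"] by simp
  have "K \<lhd> G"
    unfolding normal_inv_iff
  proof (intro conjI ballI)
    show "subgroup K G"
      by (rule subgroupI) (auto simp: K_def f_mult f_one f_inv intro!: exI[of _ \<one>])
    fix g x assume g: "g \<in> carrier G" and x: "x \<in> K"
    then have xH: "x \<in> H" and cH: "conj g x \<in> H"
      by (auto simp: K_def)
    have "conj (inv g) (f (conj g x)) = \<one>"
      using f_conj[of "inv g" x] g x xH by (simp add: K_def)
    then have "conj g (conj (inv g) (f (conj g x))) = \<one>"
      using g by simp
    then have "f (conj g x) = \<one>"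
      using g f_closed[OF cH] by (simp add: conj_conj)
    then show "g \<otimes> x \<otimes> inv g \<in> K"
      using cH by (simp add: K_def conj_def)
  qed
  moreover have "bij_betw (\<lambda>(n, k). n \<otimes> k) (N \<times> K) H"
  proof (rule bij_betwI[where g = "\<lambda>x. (f x, inv (f x) \<otimes> x)"])
    show "(\<lambda>(n, k). n \<otimes> k) \<in> N \<times> K \<rightarrow> H"
      by (auto simp: K_def)
    show "(\<lambda>x. (f x, inv (f x) \<otimes> x)) \<in> H \<rightarrow> N \<times> K"
      using f_closed f_mult f(2) by (auto simp: K_def)
    show "(\<lambda>x. (f x, inv (f x) \<otimes> x)) ((\<lambda>(n, k). n \<otimes> k) z) = z" if "z \<in> N \<times> K" for z
      using that f_mult f(2) by (auto simp: K_def)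
    show "(\<lambda>(n, k). n \<otimes> k) ((\<lambda>x. (f x, inv (f x) \<otimes> x)) x) = x" if "x \<in> H" for x
      using that f_closed by simp
  qed
  then have "card N * card K = m * card N"
    using bij_betw_same_card card_cartesian_product card_H by metis
  then have "card K = m"
    using finN by (auto simp: card_gt_0_iff)
  ultimately show ?thesis
    by blast
qed

end

section \<open>Irreducible representations and their characters\<close>

lemma invariant_subspace_iff:
  "invariant_subspace G n \<rho> W \<longleftrightarrow>
     W \<subseteq> carrier_vec n \<and> 0\<^sub>v n \<in> W \<and> (\<forall>v\<in>W. \<forall>w\<in>W. v + w \<in> W) \<and> (\<forall>c. \<forall>v\<in>W. c \<cdot>\<^sub>v v \<in> W) \<and>
     (\<forall>g\<in>carrier G. \<forall>w\<in>W. \<rho> g *\<^sub>v w \<in> W)"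
  unfolding invariant_subspace_def VectorSpace.subspace_def LinearCombinations.submodule_def
  using vec_vs[where ?'a = complex] vec_module[where ?'a = complex]
  by (auto simp: module_vec_simps class_ring_simps)

lemma GL_complex_simps:
  "\<one>\<^bsub>GL_complex n\<^esub> = 1\<^sub>m n" "x \<otimes>\<^bsub>GL_complex n\<^esub> y = x * y"
  "carrier (GL_complex n) = {A \<in> carrier_mat n n. \<exists>B\<in>carrier_mat n n. B * A = 1\<^sub>m n \<and> A * B = 1\<^sub>m n}"
  by (simp_all add: GL_complex_def units_of_def ring_mat_def Units_def)

lemma group_GL_complex: "group (GL_complex n)"
  unfolding GL_complex_def by (rule monoid.units_group[OF ring.is_monoid[OF ring_mat]])

context group
begin

lemma matrix_representationI:
  assumes "\<And>g. g \<in> carrier G \<Longrightarrow> \<rho> g \<in> carrier_mat n n" "\<rho> \<one> = 1\<^sub>m n"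
    and "\<And>g h. g \<in> carrier G \<Longrightarrow> h \<in> carrier G \<Longrightarrow> \<rho> (g \<otimes> h) = \<rho> g * \<rho> h"
  shows "matrix_representation G n \<rho>"
proof -
  have "\<rho> (inv g) * \<rho> g = 1\<^sub>m n" "\<rho> g * \<rho> (inv g) = 1\<^sub>m n" if "g \<in> carrier G" for g
    using assms(2) assms(3)[of "inv g" g] assms(3)[of g "inv g"] that by simp_all
  then show ?thesis
    unfolding matrix_representation_def hom_def GL_complex_simps
    using assms by (auto simp: Pi_def intro!: bexI[of _ "\<rho> (inv _)"])
qed

lemma matrix_representationD:
  assumes "matrix_representation G n \<rho>"
  shows "\<And>g. g \<in> carrier G \<Longrightarrow> \<rho> g \<in> carrier_mat n n"
    and "\<rho> \<one> = 1\<^sub>m n"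
    and "\<And>g h. g \<in> carrier G \<Longrightarrow> h \<in> carrier G \<Longrightarrow> \<rho> (g \<otimes> h) = \<rho> g * \<rho> h"
proof -
  interpret h: group_hom G "GL_complex n" \<rho>
    using assms group_GL_complex
    by (auto simp: matrix_representation_def group_hom_def group_hom_axioms_def)
  show "\<rho> \<one> = 1\<^sub>m n"
    using h.hom_one by (simp add: GL_complex_simps)
  show "\<rho> g \<in> carrier_mat n n" if "g \<in> carrier G" for g
    using h.hom_closed[OF that] by (simp add: GL_complex_simps)
  show "\<rho> (g \<otimes> h) = \<rho> g * \<rho> h" if "g \<in> carrier G" "h \<in> carrier G" for g h
    using h.hom_mult[OF that] by (simp add: GL_complex_simps)
qed

lemma matrix_representation_pow:
  assumes "matrix_representation G n \<rho>" "g \<in> carrier G"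
  shows "\<rho> (g [^] (k::nat)) = \<rho> g ^\<^sub>m k"
  using matrix_representationD[OF assms(1)] assms(2)
  by (induction k) (simp_all add: carrier_matD[of _ n n])

lemma char_degree_character_of:
  assumes "irreducible_representation G n \<rho>"
  shows "char_degree G (character_of G \<rho>) = n"
proof -
  have "matrix_representation G n \<rho>" "character_of G \<rho> \<in> Irr G"
    using assms by (auto simp: irreducible_representation_def Irr_def)
  then have "of_nat (char_degree G (character_of G \<rho>)) = (of_nat n :: complex)"
    using of_nat_char_degree[OF is_group] character_of_one[OF is_group] by metis
  then show ?thesis
    by simp
qed

lemma IrrE:
  assumes "\<chi> \<in> Irr G"
  obtains \<rho> where "irreducible_representation G (char_degree G \<chi>) \<rho>" "\<chi> = character_of G \<rho>"
  using assms char_degree_character_of unfolding Irr_def by auto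

lemma char_degree_pos: "\<chi> \<in> Irr G \<Longrightarrow> char_degree G \<chi> > 0"
  by (erule IrrE) (auto simp: irreducible_representation_def)

end

section \<open>Finitely many irreducible characters\<close>

lemma mat_trace_comm:
  fixes A :: "complex mat"
  assumes "A \<in> carrier_mat n n" "B \<in> carrier_mat n n"
  shows "mat_trace (A * B) = mat_trace (B * A)"
proof -
  have "mat_trace (A * B) = (\<Sum>i<n. \<Sum>j<n. A $$ (i, j) * B $$ (j, i))"
    using assms by (simp add: mat_trace_def scalar_prod_def atLeast0LessThan)
  also have "\<dots> = (\<Sum>j<n. \<Sum>i<n. B $$ (j, i) * A $$ (i, j))"
    by (subst sum.swap) (simp add: mult.commute)
  also have "\<dots> = mat_trace (B * A)"
    using assms by (simp add: mat_trace_def scalar_prod_def atLeast0LessThan)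
  finally show ?thesis .
qed

text \<open>After Schur triangularization the diagonal consists of eigenvalues of \<open>A\<close>,
  and their \<open>k\<close>-th powers are eigenvalues of the identity.\<close>

lemma mat_trace_finite_order:
  fixes A :: "complex mat"
  assumes A: "A \<in> carrier_mat n n" and pow: "A ^\<^sub>m k = 1\<^sub>m n"
  shows "\<exists>es. length es = n \<and> set es \<subseteq> {z. z ^ k = 1} \<and> mat_trace A = sum_list es"
proof -
  obtain es where "char_poly A = (\<Prod>a\<leftarrow>es. [:- a, 1:])"
    using char_poly_factorized[OF A] by blast
  then obtain B where B: "B \<in> carrier_mat n n" "upper_triangular B" and sim: "similar_mat A B"
    using schur_decomposition_exists[OF A] by blast
  then obtain P Q where "similar_mat_wit A B P Q"
    unfolding similar_mat_def by blast
  note PQ = similar_mat_witD2[OF A this]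
  have "mat_trace A = mat_trace (Q * (P * B))"
    unfolding PQ(3) using PQ B by (intro mat_trace_comm[of _ n]) auto
  also have "Q * (P * B) = B"
    using PQ B by (simp add: assoc_mult_mat[of Q n n P n B n, symmetric])
  finally have tr: "mat_trace A = sum_list (diag_mat B)"
    using B by (simp add: mat_trace_def diag_mat_def sum_list_sum_nth atLeast0LessThan)
  have "e ^ k = 1" if e: "e \<in> set (diag_mat B)" for e
  proof -
    have "poly (char_poly A) e = 0"
      unfolding char_poly_similar[OF sim] char_poly_upper_triangular[OF B]
      using e by (simp add: poly_prod_list o_def prod_list_zero_iff image_iff)
    then obtain v where v: "eigenvector A v e"
      using eigenvalue_root_char_poly[OF A] unfolding eigenvalue_def by blast
    then have vn: "v \<in> carrier_vec n" "v \<noteq> 0\<^sub>v n"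
      using A by (auto simp: eigenvector_def)
    have "1 \<cdot>\<^sub>v v = e ^ k \<cdot>\<^sub>v v"
      using eigenvector_pow[OF A v, of k] vn unfolding pow by simp
    moreover obtain i where "i < n" "v $ i \<noteq> 0"
      using vn by (metis carrier_vecD eq_vecI index_zero_vec)
    ultimately show ?thesis
      using vn by (metis carrier_vecD index_smult_vec(1) mult_cancel_right)
  qed
  moreover have "length (diag_mat B) = n"
    using B by (simp add: diag_mat_def)
  ultimately show ?thesis
    using tr by blast
qed

context finite_group
begin

text \<open>An irreducible representation space is spanned by the orbit of any nonzero vector.\<close>

lemma irreducible_degree_le:
  assumes "irreducible_representation G n \<rho>"
  shows "n \<le> Coset.order G"
proof -
  note fin_carrier = fin
  interpret vec_space "TYPE(complex)" n .
  have rep: "matrix_representation G n \<rho>" and n: "n > 0"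
    and irr: "\<And>W. invariant_subspace G n \<rho> W \<Longrightarrow> W = {0\<^sub>v n} \<or> W = carrier_vec n"
    using assms by (auto simp: irreducible_representation_def)
  note \<rho> = matrix_representationD[OF rep]
  let ?v = "unit_vec n 0 :: complex vec"
  define S where "S = (\<lambda>g. \<rho> g *\<^sub>v ?v) ` carrier G"
  have S: "S \<subseteq> carrier_vec n" "finite S"
    unfolding S_def using \<rho>(1) fin_carrier by (auto intro!: mult_mat_vec_carrier[of _ n n])
  have sub: "submodule class_ring (span S) V"
    using S by (intro span_is_submodule) (simp add: module_vec_simps)
  have closed: "\<rho> g *\<^sub>v w \<in> span S" if g: "g \<in> carrier G" and w: "w \<in> span S" for g w
  proof -
    \<comment> \<open>The preimage of the span under \<open>\<rho> g\<close> is a subspace that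
      contains \<open>S\<close>, hence contains the span.\<close>
    let ?U = "{w \<in> carrier_vec n. \<rho> g *\<^sub>v w \<in> span S}"
    have "\<rho> g *\<^sub>v 0\<^sub>v n = 0\<^sub>v n"
      using \<rho>(1)[OF g] by (intro eq_vecI) auto
    then have "submodule class_ring ?U V"
      using sub \<rho>(1)[OF g] unfolding LinearCombinations.submodule_def
      by (auto simp: module_vec_simps class_ring_simps mult_add_distrib_mat_vec mult_mat_vec)
    moreover have "S \<subseteq> ?U"
    proof
      fix s assume "s \<in> S"
      then obtain h where h: "h \<in> carrier G" "s = \<rho> h *\<^sub>v ?v"
        unfolding S_def by blast
      then have "\<rho> g *\<^sub>v s = \<rho> (g \<otimes> h) *\<^sub>v ?v"
        using \<rho> g by (simp add: assoc_mult_mat_vec[of _ n n _ n])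
      then have "\<rho> g *\<^sub>v s \<in> S"
        using g h by (simp add: S_def)
      then show "s \<in> ?U"
        using S in_own_span[of S] \<open>s \<in> S\<close> by (auto simp: module_vec_simps)
    qed
    ultimately show ?thesis
      using span_is_subset w by blast
  qed
  have "invariant_subspace G n \<rho> (span S)"
    unfolding invariant_subspace_def VectorSpace.subspace_def using sub vec_vs closed by blast
  moreover have "\<rho> \<one> *\<^sub>v ?v \<in> S"
    unfolding S_def by blast
  then have "?v \<in> span S"
    using in_own_span[of S] S \<rho>(2) by (auto simp: module_vec_simps)
  then have "span S \<noteq> {0\<^sub>v n}"
    using n by auto
  ultimately have "span S = carrier_vec n"
    using irr by blast
  then have "dim \<le> card S"
    using S by (intro gen_ge_dim) (simp_all add: module_vec_simps)
  also have "\<dots> \<le> card (carrier G)"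
    unfolding S_def using fin_carrier by (rule card_image_le)
  finally show ?thesis
    by (simp add: dim_is_n Coset.order_def)
qed

text \<open>Degrees are bounded by the group order and each value is a sum of roots of unity, as
  many as the degree, so only finitely many functions can occur. Without finiteness the sums and
  cardinalities in \<open>acd_p'\<close> could take their default value 0.\<close>

lemma finite_Irr: "finite (Irr G)"
proof (rule finite_subset)
  let ?k = "Coset.order G"
  let ?R = "{z::complex. z ^ ?k = 1}"
  let ?T = "\<Union>n\<le>?k. sum_list ` {es. set es \<subseteq> ?R \<and> length es = n}"
  have "finite ?R"
    using order_pos by (intro finite_roots_unity) simp
  then show "finite (\<Pi>\<^sub>E x\<in>carrier G. ?T)"
    using fin by (intro finite_PiE finite_UN_I finite_imageI finite_lists_length_eq) auto
  show "Irr G \<subseteq> (\<Pi>\<^sub>E x\<in>carrier G. ?T)"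
  proof
    fix \<chi> assume "\<chi> \<in> Irr G"
    then obtain n \<rho> where \<chi>: "\<chi> = character_of G \<rho>" and irr: "irreducible_representation G n \<rho>"
      by (auto simp: Irr_def)
    then have rep: "matrix_representation G n \<rho>"
      by (simp add: irreducible_representation_def)
    have "mat_trace (\<rho> g) \<in> ?T" if g: "g \<in> carrier G" for g
    proof -
      have "\<rho> g ^\<^sub>m ?k = 1\<^sub>m n"
        using matrix_representation_pow[OF rep g, of ?k] matrix_representationD(2)[OF rep] g
        by (simp add: pow_order_eq_1)
      from mat_trace_finite_order[OF matrix_representationD(1)[OF rep g] this]
      show ?thesis
        using irreducible_degree_le[OF irr] by (auto simp: image_iff)
    qed
    then show "\<chi> \<in> (\<Pi>\<^sub>E x\<in>carrier G. ?T)"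
      unfolding \<chi> character_of_def by auto
  qed
qed

section \<open>Linear characters as the irreducible characters of degree 1\<close>

lemma lin_char_Irr:
  assumes "\<mu> \<in> lin_chars G"
  shows "\<mu> \<in> Irr G" "char_degree G \<mu> = 1"
proof -
  let ?\<rho> = "\<lambda>g. mat 1 1 (\<lambda>_. \<mu> g)"
  have "matrix_representation G 1 ?\<rho>"
  proof (rule matrix_representationI)
    show "?\<rho> (g \<otimes> h) = ?\<rho> g * ?\<rho> h" if "g \<in> carrier G" "h \<in> carrier G" for g h
      using that assms by (intro eq_matI) (simp_all add: scalar_prod_def lin_char_mult)
  qed (use assms in \<open>auto intro!: eq_matI simp: lin_char_one\<close>)
  moreover have "W = carrier_vec 1"
    if W: "invariant_subspace G 1 ?\<rho> W" "W \<noteq> {0\<^sub>v 1}" for W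
  proof
    show "W \<subseteq> carrier_vec 1"
      using W(1) by (simp add: invariant_subspace_iff)
    obtain w where w: "w \<in> W" "w \<noteq> 0\<^sub>v 1"
      using W by (auto simp: invariant_subspace_iff)
    then have wc: "w \<in> carrier_vec 1"
      using W(1) by (auto simp: invariant_subspace_iff)
    then have w0: "w $ 0 \<noteq> 0"
      using w(2) by (metis carrier_vecD eq_vecI index_zero_vec less_one)
    show "carrier_vec 1 \<subseteq> W"
    proof
      fix v :: "complex vec" assume v: "v \<in> carrier_vec 1"
      have "v = (v $ 0 / w $ 0) \<cdot>\<^sub>v w"
        using v wc w0 by (intro eq_vecI) auto
      then show "v \<in> W"
        using W(1) w(1) by (metis invariant_subspace_iff)
    qed
  qed
  ultimately have irr: "irreducible_representation G 1 ?\<rho>"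
    unfolding irreducible_representation_def by auto
  have char: "character_of G ?\<rho> = \<mu>"
    using lin_char_ext[OF assms] by (auto simp: character_of_def mat_trace_def extensional_def)
  show "\<mu> \<in> Irr G"
    unfolding Irr_def mem_Collect_eq using char[symmetric] irr by blast
  show "char_degree G \<mu> = 1"
    using char_degree_character_of[OF irr] unfolding char .
qed

lemma degree_one_lin_char:
  assumes "\<chi> \<in> Irr G" "char_degree G \<chi> = 1"
  shows "\<chi> \<in> lin_chars G"
proof -
  obtain \<rho> where "irreducible_representation G 1 \<rho>" and \<chi>: "\<chi> = character_of G \<rho>"
    using IrrE[OF assms(1)] assms(2) by metis
  then have rep: "matrix_representation G 1 \<rho>"
    by (simp add: irreducible_representation_def)
  note \<rho> = matrix_representationD[OF rep]
  have val: "\<chi> g = \<rho> g $$ (0, 0)" if "g \<in> carrier G" for g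
    using \<rho>(1)[OF that] that by (simp add: \<chi> character_of_def mat_trace_def)
  show ?thesis
    unfolding lin_chars_def
  proof (intro CollectI conjI ballI)
    show "\<chi> \<in> extensional (carrier G)"
      by (simp add: \<chi> character_of_def)
    show "\<chi> \<one> = 1"
      using \<rho>(2) by (simp add: val)
    show "\<chi> (g \<otimes> h) = \<chi> g * \<chi> h" if "g \<in> carrier G" "h \<in> carrier G" for g h
      using that \<rho>(1)[OF that(1)] \<rho>(1)[OF that(2)] by (simp add: val \<rho>(3) scalar_prod_def)
  qed
qed

end

section \<open>Inflation of characters from a quotient\<close>

context normal
begin

lemma irreducible_representation_inflate:
  assumes "irreducible_representation (G Mod H) n \<rho>"
  shows "irreducible_representation G n (\<lambda>g. \<rho> (H #> g))"
proof -
  interpret Q: group "G Mod H"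
    by (rule factorgroup_is_group)
  have car: "carrier (G Mod H) = (\<lambda>g. H #> g) ` carrier G"
    by (rule carrier_FactGroup)
  have rep: "matrix_representation (G Mod H) n \<rho>"
    using assms by (simp add: irreducible_representation_def)
  note \<rho> = Q.matrix_representationD[OF rep]
  have "matrix_representation G n (\<lambda>g. \<rho> (H #> g))"
  proof (rule matrix_representationI)
    show "\<rho> (H #> g) \<in> carrier_mat n n" if "g \<in> carrier G" for g
      using that \<rho>(1) car by auto
    show "\<rho> (H #> \<one>) = 1\<^sub>m n"
      using \<rho>(2) subset by (simp add: coset_mult_one)
    show "\<rho> (H #> (g \<otimes> h)) = \<rho> (H #> g) * \<rho> (H #> h)" if "g \<in> carrier G" "h \<in> carrier G" for g h
      using \<rho>(3)[of "H #> g" "H #> h"] that car by (simp add: rcos_sum)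
  qed
  moreover have "invariant_subspace (G Mod H) n \<rho> W \<longleftrightarrow> invariant_subspace G n (\<lambda>g. \<rho> (H #> g)) W" for W
    unfolding invariant_subspace_def car by auto
  ultimately show ?thesis
    using assms unfolding irreducible_representation_def by blast
qed

definition inflate :: "('a set \<Rightarrow> complex) \<Rightarrow> 'a \<Rightarrow> complex" where
  "inflate \<chi> = (\<lambda>g\<in>carrier G. \<chi> (H #> g))"

lemma inflate_character_of: "inflate (character_of (G Mod H) \<rho>) = character_of G (\<lambda>g. \<rho> (H #> g))"
  by (auto simp: inflate_def character_of_def carrier_FactGroup)

lemma inflate_Irr:
  assumes "\<chi> \<in> Irr (G Mod H)"
  shows "inflate \<chi> \<in> Irr G" "char_degree G (inflate \<chi>) = char_degree (G Mod H) \<chi>"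
proof -
  obtain \<rho> where irr: "irreducible_representation (G Mod H) (char_degree (G Mod H) \<chi>) \<rho>"
    and \<chi>: "\<chi> = character_of (G Mod H) \<rho>"
    using group.IrrE[OF factorgroup_is_group assms] by blast
  note inf = irreducible_representation_inflate[OF irr]
  show "inflate \<chi> \<in> Irr G"
    using inf unfolding \<chi> inflate_character_of Irr_def by blast
  show "char_degree G (inflate \<chi>) = char_degree (G Mod H) \<chi>"
    using char_degree_character_of[OF inf] by (simp add: \<chi> inflate_character_of)
qed

lemma inflate_inj:
  "inj_on inflate (extensional (carrier (G Mod H)))"
proof (rule inj_onI, rule extensionalityI[of _ "carrier (G Mod H)"])
  fix \<chi> \<psi> C assume eq: "inflate \<chi> = inflate \<psi>" and "C \<in> carrier (G Mod H)"
  then obtain g where g: "g \<in> carrier G" "C = H #> g"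
    by (auto simp: carrier_FactGroup)
  then show "\<chi> C = \<psi> C"
    using fun_cong[OF eq, of g] by (simp add: inflate_def)
qed

text \<open>Used to see that an irreducible character that is not inflated has degree at least 2
  when all linear characters are trivial on \<open>H\<close>.\<close>

lemma lin_char_deflate:
  assumes "\<mu> \<in> lin_chars G" "\<And>h. h \<in> H \<Longrightarrow> \<mu> h = 1"
  obtains \<nu> where "\<nu> \<in> lin_chars (G Mod H)" "inflate \<nu> = \<mu>"
proof
  define \<nu> where "\<nu> = (\<lambda>C\<in>carrier (G Mod H). \<mu> (SOME x. x \<in> C))"
  have val: "\<nu> (H #> g) = \<mu> g" if g: "g \<in> carrier G" for g
  proof -
    have "(SOME x. x \<in> H #> g) \<in> H #> g"
      by (rule someI[of _ g]) (rule rcos_self[OF g is_subgroup])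
    then obtain h where h: "h \<in> H" "(SOME x. x \<in> H #> g) = h \<otimes> g"
      unfolding r_coset_def by blast
    then show ?thesis
      using g assms by (auto simp: \<nu>_def carrier_FactGroup lin_chars_def)
  qed
  show "\<nu> \<in> lin_chars (G Mod H)"
    unfolding lin_chars_def
  proof (intro CollectI conjI ballI)
    show "\<nu> \<one>\<^bsub>G Mod H\<^esub> = 1"
      using val[of \<one>] assms(1) subset by (simp add: lin_chars_def coset_mult_one)
    fix C D assume "C \<in> carrier (G Mod H)" "D \<in> carrier (G Mod H)"
    then obtain g h where "g \<in> carrier G" "C = H #> g" "h \<in> carrier G" "D = H #> h"
      by (auto simp: carrier_FactGroup)
    then show "\<nu> (C \<otimes>\<^bsub>G Mod H\<^esub> D) = \<nu> C * \<nu> D"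
      using assms(1) val by (simp add: rcos_sum lin_chars_def)
  qed (auto simp: \<nu>_def)
  show "inflate \<nu> = \<mu>"
    using val assms(1) unfolding inflate_def
    by (intro extensionalityI[of _ "carrier G"]) (auto simp: lin_chars_def)
qed

end

section \<open>Monomial representations of split extensions\<close>

locale split_extension = abelian_normal N G for N and G (structure) +
  fixes F :: "'a \<Rightarrow> 'a"
  assumes F: "crossed_hom (carrier G) F" and F_N: "n \<in> N \<Longrightarrow> F n = n"
begin

section \<open>The action of G on the characters of N\<close>

sublocale dual: finite_group NN
  rewrites "carrier NN = N" and "monoid.mult NN = monoid.mult G" and "monoid.one NN = \<one>"
  by unfold_locales (simp_all add: finN)

text \<open>The inverse turns precomposition with conjugation into a left action.\<close>

definition act :: "'a \<Rightarrow> ('a \<Rightarrow> complex) \<Rightarrow> 'a \<Rightarrow> complex" where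
  "act g l = (\<lambda>n\<in>N. l (conj (inv g) n))"

lemma F_closed [simp]: "g \<in> carrier G \<Longrightarrow> F g \<in> N"
  using crossed_hom_closed[OF F] .

lemma F_mult: "g \<in> carrier G \<Longrightarrow> h \<in> carrier G \<Longrightarrow> F (g \<otimes> h) = F g \<otimes> conj g (F h)"
  using crossed_hom_mult[OF F] .

lemma act_closed:
  assumes "g \<in> carrier G" "l \<in> lin_chars NN"
  shows "act g l \<in> lin_chars NN"
  using assms dual.lin_char_mult[OF assms(2)] dual.lin_char_one[OF assms(2)]
  by (simp add: lin_chars_def act_def conj_mult)

lemma act_mult:
  assumes "g \<in> carrier G" "h \<in> carrier G"
  shows "act (g \<otimes> h) l = act g (act h l)"
  using assms by (auto simp: act_def conj_conj inv_mult_group)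

lemma act_one:
  assumes "l \<in> lin_chars NN"
  shows "act \<one> l = l"
  using dual.lin_char_ext[OF assms] by (auto simp: act_def extensional_def)

lemma act_N:
  assumes "n \<in> N" "l \<in> lin_chars NN"
  shows "act n l = l"
  using assms(1) dual.lin_char_ext[OF assms(2)] by (auto simp: act_def extensional_def conj_N_trivial)

definition dual_action :: "'a \<Rightarrow> ('a \<Rightarrow> complex) \<Rightarrow> 'a \<Rightarrow> complex" where
  "dual_action g = (\<lambda>l\<in>lin_chars NN. act g l)"

lemma act_inv:
  assumes "g \<in> carrier G" "l \<in> lin_chars NN"
  shows "act (inv g) (act g l) = l" "act g (act (inv g) l) = l"
  using assms by (simp_all add: act_mult[symmetric] act_one)

sublocale dual_action: group_action G "lin_chars NN" dual_action
proof (intro group_action.intro group_hom.intro group_hom_axioms.intro)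
  have "dual_action g \<in> carrier (BijGroup (lin_chars NN))" if "g \<in> carrier G" for g
    using that act_closed act_inv unfolding BijGroup_def Bij_def dual_action_def
    by (auto intro!: bij_betwI[where g = "act (inv g)"])
  then show "dual_action \<in> hom G (BijGroup (lin_chars NN))"
    by (auto simp: hom_def BijGroup_def compose_def dual_action_def act_mult act_closed)
qed (rule is_group group_BijGroup)+

abbreviation dual_orbits where "dual_orbits \<equiv> orbits G (lin_chars NN) dual_action"

lemma orbit_dual:
  assumes "l \<in> lin_chars NN"
  shows "orbit G dual_action l = (\<lambda>g. act g l) ` carrier G"
  using assms by (auto simp: orbit_def dual_action_def)

lemma dual_orbit_subset: "O1 \<in> dual_orbits \<Longrightarrow> O1 \<subseteq> lin_chars NN"
  by (auto simp: orbits_def orbit_dual act_closed)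

lemma finite_dual_orbit: "O1 \<in> dual_orbits \<Longrightarrow> finite O1"
  using dual_orbit_subset dual.finite_lin_chars finite_subset by blast

lemma dual_orbit_eq:
  assumes "O1 \<in> dual_orbits" "l \<in> O1"
  shows "O1 = (\<lambda>g. act g l) ` carrier G"
proof -
  have l: "l \<in> lin_chars NN"
    using assms dual_orbit_subset by blast
  then have "orbit G dual_action l \<in> dual_orbits" "l \<in> orbit G dual_action l"
    using dual_action.orbit_refl by (auto simp: orbits_def)
  then show ?thesis
    using dual_action.disjoint_union[OF assms(1)] assms(2) orbit_dual[OF l] by blast
qed

lemma act_dual_orbit: "O1 \<in> dual_orbits \<Longrightarrow> l \<in> O1 \<Longrightarrow> g \<in> carrier G \<Longrightarrow> act g l \<in> O1"
  using dual_orbit_eq by blast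

text \<open>The character induced from the stabilizer of a point of the orbit. It is written without
  an enumeration of the orbit, so that characters for different orbits and different
  \<open>\<mu>\<close> can be compared. Where \<open>g\<close> fixes \<open>l\<close>, the cocycle
  law makes \<open>l (F g)\<close> multiplicative.\<close>

definition orbit_char :: "('a \<Rightarrow> complex) set \<Rightarrow> ('a \<Rightarrow> complex) \<Rightarrow> 'a \<Rightarrow> complex" where
  "orbit_char O1 \<mu> = (\<lambda>g\<in>carrier G. \<Sum>l\<in>{l \<in> O1. act g l = l}. l (F g) * \<mu> g)"

text \<open>The monomial representation induced from the extension \<open>g \<mapsto> l (F g) * \<mu> g\<close> of a character
  \<open>l\<close> of \<open>N\<close> to its stabilizer; \<open>e\<close> enumerates the orbit of \<open>l\<close>.\<close>

definition monomial_rep ::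
    "nat \<Rightarrow> (nat \<Rightarrow> 'a \<Rightarrow> complex) \<Rightarrow> ('a \<Rightarrow> complex) \<Rightarrow> 'a \<Rightarrow> complex mat" where
  "monomial_rep d e \<mu> g = mat d d (\<lambda>(i, j). if e i = act g (e j) then e i (F g) * \<mu> g else 0)"

context
  fixes O1 :: "('a \<Rightarrow> complex) set" and d :: nat and e :: "nat \<Rightarrow> 'a \<Rightarrow> complex"
    and \<mu> :: "'a \<Rightarrow> complex"
  assumes O1: "O1 \<in> dual_orbits" and e: "bij_betw e {..<d} O1" and \<mu>: "\<mu> \<in> lin_chars G"
begin

lemma e_in: "i < d \<Longrightarrow> e i \<in> O1"
  using e by (auto simp: bij_betw_def)

lemma e_lin: "i < d \<Longrightarrow> e i \<in> lin_chars NN"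
  using e_in dual_orbit_subset[OF O1] by blast

lemma e_eq_iff: "i < d \<Longrightarrow> j < d \<Longrightarrow> e i = e j \<longleftrightarrow> i = j"
  using e by (auto simp: bij_betw_def inj_on_def)

lemma act_e_obtain:
  assumes "g \<in> carrier G" "j < d"
  obtains k where "k < d" "act g (e j) = e k"
  using act_dual_orbit[OF O1 e_in[OF assms(2)] assms(1)] e that by (auto simp: bij_betw_def image_iff)

lemma monomial_rep_carrier: "monomial_rep d e \<mu> g \<in> carrier_mat d d"
  by (simp add: monomial_rep_def)

lemma monomial_rep_index:
  assumes "g \<in> carrier G" "i < d" "j < d" "k < d" "act g (e j) = e k"
  shows "monomial_rep d e \<mu> g $$ (i, j) = (if i = k then e k (F g) * \<mu> g else 0)"
  using assms by (auto simp: monomial_rep_def e_eq_iff)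

lemma monomial_rep_mult:
  assumes g: "g \<in> carrier G" and h: "h \<in> carrier G"
  shows "monomial_rep d e \<mu> (g \<otimes> h) = monomial_rep d e \<mu> g * monomial_rep d e \<mu> h"
proof (rule eq_matI)
  fix i k assume "i < dim_row (monomial_rep d e \<mu> g * monomial_rep d e \<mu> h)"
    "k < dim_col (monomial_rep d e \<mu> g * monomial_rep d e \<mu> h)"
  then have i: "i < d" and k: "k < d"
    by (simp_all add: monomial_rep_def)
  obtain j where j: "j < d" "act h (e k) = e j"
    using act_e_obtain[OF h k] .
  obtain r where r: "r < d" "act g (e j) = e r"
    using act_e_obtain[OF g j(1)] .
  have ghc: "g \<otimes> h \<in> carrier G"
    using g h by simp
  have gh: "act (g \<otimes> h) (e k) = e r"
    using act_mult[OF g h] j r by simp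
  have "(monomial_rep d e \<mu> g * monomial_rep d e \<mu> h) $$ (i, k) =
      (\<Sum>t<d. monomial_rep d e \<mu> g $$ (i, t) * monomial_rep d e \<mu> h $$ (t, k))"
    using i k by (simp add: monomial_rep_def scalar_prod_def atLeast0LessThan)
  also have "\<dots> = (\<Sum>t<d. if t = j then monomial_rep d e \<mu> g $$ (i, j) * (e j (F h) * \<mu> h) else 0)"
    using monomial_rep_index[OF h _ k j] by (intro sum.cong) auto
  also have "\<dots> = monomial_rep d e \<mu> g $$ (i, j) * (e j (F h) * \<mu> h)"
    using j by simp
  also have "\<dots> = (if i = r then e r (F g) * \<mu> g * (e j (F h) * \<mu> h) else 0)"
    using monomial_rep_index[OF g i j(1) r] by simp
  \<comment> \<open>Passing from \<open>e j\<close> to \<open>e r\<close> conjugates the argument by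
    \<open>g\<close>, which produces the second factor of \<open>F (g \<otimes> h)\<close>.\<close>
  also have "e j (F h) = e r (conj g (F h))"
    using g h by (simp add: r(2)[symmetric] act_def conj_conj)
  also have "(if i = r then e r (F g) * \<mu> g * (e r (conj g (F h)) * \<mu> h) else 0) =
      monomial_rep d e \<mu> (g \<otimes> h) $$ (i, k)"
    using monomial_rep_index[OF ghc i k r(1) gh] g h
      dual.lin_char_mult[OF e_lin[OF r(1)]] lin_char_mult[OF \<mu>]
    by (simp add: F_mult)
  finally show "monomial_rep d e \<mu> (g \<otimes> h) $$ (i, k) =
      (monomial_rep d e \<mu> g * monomial_rep d e \<mu> h) $$ (i, k)" ..
qed (simp_all add: monomial_rep_def)

lemma monomial_rep_one: "monomial_rep d e \<mu> \<one> = 1\<^sub>m d"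
proof (rule eq_matI)
  show "monomial_rep d e \<mu> \<one> $$ (i, j) = 1\<^sub>m d $$ (i, j)" if "i < dim_row (1\<^sub>m d)" "j < dim_col (1\<^sub>m d)" for i j
    using that monomial_rep_index[of \<one> i j j] act_one[OF e_lin[of j]] F_N[of \<one>] lin_char_one[OF \<mu>]
      dual.lin_char_one[OF e_lin[of j]] by auto
qed (simp_all add: monomial_rep_def)

lemma monomial_matrix_representation: "matrix_representation G d (monomial_rep d e \<mu>)"
  by (rule matrix_representationI)
    (simp_all add: monomial_rep_carrier monomial_rep_one monomial_rep_mult)

lemma monomial_rep_N:
  assumes "n \<in> N" "\<mu> n = 1" "w \<in> carrier_vec d" "i < d"
  shows "(monomial_rep d e \<mu> n *\<^sub>v w) $ i = e i n * w $ i"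
proof -
  have "(monomial_rep d e \<mu> n *\<^sub>v w) $ i = (\<Sum>j<d. monomial_rep d e \<mu> n $$ (i, j) * w $ j)"
    using assms by (simp add: monomial_rep_def scalar_prod_def atLeast0LessThan)
  also have "\<dots> = (\<Sum>j<d. if j = i then e i n * w $ i else 0)"
    using assms act_N[OF assms(1) e_lin] F_N[OF assms(1)]
    by (intro sum.cong) (auto simp: monomial_rep_index)
  also have "\<dots> = e i n * w $ i"
    using assms by simp
  finally show ?thesis .
qed

lemma monomial_rep_unit_vec:
  assumes "g \<in> carrier G" "j < d" "k < d" "act g (e j) = e k"
  shows "monomial_rep d e \<mu> g *\<^sub>v unit_vec d j = (e k (F g) * \<mu> g) \<cdot>\<^sub>v unit_vec d k"
proof (rule eq_vecI)
  fix i assume "i < dim_vec ((e k (F g) * \<mu> g) \<cdot>\<^sub>v unit_vec d k)"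
  then have i: "i < d"
    by simp
  have "(monomial_rep d e \<mu> g *\<^sub>v unit_vec d j) $ i =
      (\<Sum>t<d. monomial_rep d e \<mu> g $$ (i, t) * unit_vec d j $ t)"
    using i by (simp add: monomial_rep_def scalar_prod_def atLeast0LessThan)
  also have "\<dots> = (\<Sum>t<d. if t = j then monomial_rep d e \<mu> g $$ (i, j) else 0)"
    using assms(2) by (intro sum.cong) auto
  also have "\<dots> = (if i = k then e k (F g) * \<mu> g else 0)"
    using assms i monomial_rep_index[OF assms(1) i assms(2-4)] by simp
  finally show "(monomial_rep d e \<mu> g *\<^sub>v unit_vec d j) $ i = ((e k (F g) * \<mu> g) \<cdot>\<^sub>v unit_vec d k) $ i"
    using i assms by simp
qed (simp add: monomial_rep_def)

text \<open>\<open>N\<close> acts diagonally with pairwise distinct characters, so a nonzero vector of minimal support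
  in an invariant subspace is a multiple of a basis vector; the basis vectors are permuted
  transitively up to scalars.\<close>

lemma monomial_irreducible:
  assumes trivial: "\<And>n. n \<in> N \<Longrightarrow> \<mu> n = 1"
  shows "irreducible_representation G d (monomial_rep d e \<mu>)"
proof -
  let ?\<rho> = "monomial_rep d e \<mu>"
  have "O1 \<noteq> {}"
    using O1 dual_action.orbit_refl by (auto simp: orbits_def)
  then have d: "d > 0"
    using e by (cases d) (auto simp: bij_betw_def)
  have "W = carrier_vec d" if W: "invariant_subspace G d ?\<rho> W" "W \<noteq> {0\<^sub>v d}" for W
  proof
    have sub: "W \<subseteq> carrier_vec d" "0\<^sub>v d \<in> W" and add: "\<And>v w. v \<in> W \<Longrightarrow> w \<in> W \<Longrightarrow> v + w \<in> W"
      and smult: "\<And>c v. v \<in> W \<Longrightarrow> c \<cdot>\<^sub>v v \<in> W"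
      and inv: "\<And>g w. g \<in> carrier G \<Longrightarrow> w \<in> W \<Longrightarrow> ?\<rho> g *\<^sub>v w \<in> W"
      using W(1) by (auto simp: invariant_subspace_iff)
    show "W \<subseteq> carrier_vec d"
      by (rule sub)
    define supp where "supp w = {i. i < d \<and> w $ i \<noteq> 0}" for w :: "complex vec"
    have finsupp: "finite (supp w)" for w
      by (rule finite_subset[of _ "{..<d}"]) (auto simp: supp_def)
    obtain w0 where "w0 \<in> W \<and> w0 \<noteq> 0\<^sub>v d"
      using W(2) sub by auto
    then obtain w where w: "w \<in> W" "w \<noteq> 0\<^sub>v d"
      and min: "\<And>v. v \<in> W \<Longrightarrow> v \<noteq> 0\<^sub>v d \<Longrightarrow> card (supp w) \<le> card (supp v)"
      using ex_has_least_nat[of "\<lambda>w. w \<in> W \<and> w \<noteq> 0\<^sub>v d" w0 "\<lambda>w. card (supp w)"] by blast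
    have wc: "w \<in> carrier_vec d"
      using w sub by blast
    obtain i where i: "i < d" "w $ i \<noteq> 0"
      using w(2) wc by (metis carrier_vecD eq_vecI index_zero_vec)
    have single: "w $ j = 0" if j: "j < d" "j \<noteq> i" for j
    proof (rule ccontr)
      assume wj: "w $ j \<noteq> 0"
      have "e i \<noteq> e j"
        using e_eq_iff i j by simp
      then obtain n where n: "n \<in> N" "e i n \<noteq> e j n"
        using dual.lin_chars_eqI[OF e_lin[OF i(1)] e_lin[OF j(1)]] by blast
      \<comment> \<open>This combination kills coordinate \<open>i\<close>, keeps coordinate
        \<open>j\<close> nonzero and creates no new ones, so its support is smaller.\<close>
      define v where "v = ?\<rho> n *\<^sub>v w + (- e i n) \<cdot>\<^sub>v w"
      have vW: "v \<in> W"
        unfolding v_def using add smult inv n w by simp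
      have v: "v $ k = (e k n - e i n) * w $ k" if "k < d" for k
        using that wc monomial_rep_N[OF n(1) trivial[OF n(1)] wc that]
        by (simp add: v_def algebra_simps)
      have "v \<noteq> 0\<^sub>v d"
        using v[OF j(1)] wj n j(1) by auto
      moreover have "supp v \<subseteq> supp w" "i \<in> supp w" "i \<notin> supp v"
        using i by (auto simp: supp_def v)
      then have "card (supp v) < card (supp w)"
        by (intro psubset_card_mono[OF finsupp]) blast
      ultimately show False
        using min[OF vW] by simp
    qed
    have "unit_vec d i = inverse (w $ i) \<cdot>\<^sub>v w"
      using wc i single by (intro eq_vecI) auto
    then have ui: "unit_vec d i \<in> W"
      using smult w by metis
    have unit: "unit_vec d k \<in> W" if k: "k < d" for k
    proof -
      obtain g where g: "g \<in> carrier G" "act g (e i) = e k"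
        using dual_orbit_eq[OF O1 e_in[OF i(1)]] e_in[OF k] by auto
      define c where "c = e k (F g) * \<mu> g"
      have "c \<noteq> 0"
        using dual.lin_char_nonzero[OF e_lin[OF k]] lin_char_nonzero[OF \<mu>] g by (simp add: c_def)
      moreover have "c \<cdot>\<^sub>v unit_vec d k \<in> W"
        using inv[OF g(1) ui] monomial_rep_unit_vec[OF g(1) i(1) k g(2)] by (simp add: c_def)
      then have "inverse c \<cdot>\<^sub>v (c \<cdot>\<^sub>v unit_vec d k) \<in> W"
        by (rule smult)
      ultimately show ?thesis
        by (simp add: smult_smult_assoc)
    qed
    show "carrier_vec d \<subseteq> W"
    proof
      fix v :: "complex vec" assume v: "v \<in> carrier_vec d"
      have "vec d (\<lambda>i. if i < k then v $ i else 0) \<in> W" if "k \<le> d" for k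
        using that
      proof (induction k)
        case 0
        have "vec d (\<lambda>i. if i < 0 then v $ i else 0) = 0\<^sub>v d"
          by (intro eq_vecI) auto
        then show ?case
          using sub by simp
      next
        case (Suc k)
        have "vec d (\<lambda>i. if i < Suc k then v $ i else 0) =
            vec d (\<lambda>i. if i < k then v $ i else 0) + v $ k \<cdot>\<^sub>v unit_vec d k"
          using Suc.prems by (intro eq_vecI) (auto simp: less_Suc_eq)
        then show ?case
          using Suc add smult unit by simp
      qed
      from this[of d] have "vec d (\<lambda>i. if i < d then v $ i else 0) \<in> W"
        by simp
      also have "vec d (\<lambda>i. if i < d then v $ i else 0) = v"
        using v by (intro eq_vecI) auto
      finally show "v \<in> W" .
    qed
  qed
  then show ?thesis
    unfolding irreducible_representation_def using monomial_matrix_representation d by blast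
qed

lemma character_of_monomial: "character_of G (monomial_rep d e \<mu>) = orbit_char O1 \<mu>"
proof (rule extensionalityI[of _ "carrier G"])
  fix g assume g: "g \<in> carrier G"
  have "mat_trace (monomial_rep d e \<mu> g) = (\<Sum>i<d. if act g (e i) = e i then e i (F g) * \<mu> g else 0)"
    unfolding mat_trace_def by (intro sum.cong) (auto simp: monomial_rep_def)
  also have "\<dots> = (\<Sum>l\<in>O1. if act g l = l then l (F g) * \<mu> g else 0)"
    using sum.reindex_bij_betw[OF e, of "\<lambda>l. if act g l = l then l (F g) * \<mu> g else 0"] by simp
  also have "\<dots> = (\<Sum>l\<in>{l \<in> O1. act g l = l}. l (F g) * \<mu> g)"
    using finite_dual_orbit[OF O1] by (simp add: sum.If_cases Int_def)
  finally show "character_of G (monomial_rep d e \<mu>) g = orbit_char O1 \<mu> g"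
    using g by (simp add: character_of_def orbit_char_def)
qed (simp_all add: character_of_def orbit_char_def)

end

section \<open>Counting the characters that come from an orbit\<close>

lemma orbit_char_Irr:
  assumes "O1 \<in> dual_orbits" "\<mu> \<in> lin_chars G" "\<And>n. n \<in> N \<Longrightarrow> \<mu> n = 1"
  shows "orbit_char O1 \<mu> \<in> Irr G" "char_degree G (orbit_char O1 \<mu>) = card O1"
proof -
  obtain e where e: "bij_betw e {..<card O1} O1"
    using ex_bij_betw_nat_finite[OF finite_dual_orbit[OF assms(1)]] by (auto simp: atLeast0LessThan)
  note irr = monomial_irreducible[OF assms(1) e assms(2,3)]
  note char = character_of_monomial[OF assms(1) e assms(2)]
  show "orbit_char O1 \<mu> \<in> Irr G"
    unfolding Irr_def mem_Collect_eq using irr char[symmetric] by blast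
  show "char_degree G (orbit_char O1 \<mu>) = card O1"
    using char_degree_character_of[OF irr] unfolding char .
qed

lemma orbit_char_N:
  assumes "O1 \<in> dual_orbits" "n \<in> N" "\<mu> n = 1"
  shows "orbit_char O1 \<mu> n = (\<Sum>l\<in>O1. l n)"
proof -
  have "{l \<in> O1. act n l = l} = O1"
    using act_N[OF assms(2)] dual_orbit_subset[OF assms(1)] by blast
  then show ?thesis
    using assms F_N by (simp add: orbit_char_def)
qed

text \<open>On \<open>N\<close> the character is the sum of its orbit whatever \<open>\<mu>\<close>
  is, and independence of the characters of \<open>N\<close> recovers the orbit.\<close>

lemma orbit_char_inj_orbit:
  assumes "O1 \<in> dual_orbits" "O2 \<in> dual_orbits" "\<And>n. n \<in> N \<Longrightarrow> \<mu> n = 1" "\<And>n. n \<in> N \<Longrightarrow> \<nu> n = 1"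
    and eq: "orbit_char O1 \<mu> = orbit_char O2 \<nu>"
  shows "O1 = O2"
proof -
  have finO: "finite O1" "finite O2"
    using assms finite_dual_orbit by auto
  define c where "c l = (if l \<in> O1 then 1 else 0) - (if l \<in> O2 then 1 else 0 :: complex)" for l
  have "(\<Sum>l\<in>O1 \<union> O2. c l * l n) = 0" if n: "n \<in> N" for n
  proof -
    have "(\<Sum>l\<in>O1 \<union> O2. c l * l n) =
        (\<Sum>l\<in>O1 \<union> O2. if l \<in> O1 then l n else 0) - (\<Sum>l\<in>O1 \<union> O2. if l \<in> O2 then l n else 0)"
      unfolding sum_subtractf[symmetric] by (intro sum.cong) (auto simp: c_def)
    also have "(\<Sum>l\<in>O1 \<union> O2. if l \<in> O1 then l n else 0) = orbit_char O1 \<mu> n"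
      using finO orbit_char_N[OF assms(1) n, of \<mu>] assms(3)[OF n]
      by (subst sum.inter_restrict[symmetric]) (auto simp: Int_absorb1)
    also have "(\<Sum>l\<in>O1 \<union> O2. if l \<in> O2 then l n else 0) = orbit_char O2 \<nu> n"
      using finO orbit_char_N[OF assms(2) n, of \<nu>] assms(4)[OF n]
      by (subst sum.inter_restrict[symmetric]) (auto simp: Int_absorb1)
    finally show ?thesis
      using eq by simp
  qed
  then have c0: "c l = 0" if "l \<in> O1 \<union> O2" for l
    using dual.lin_chars_independent[of "O1 \<union> O2" c l] assms(1,2) dual_orbit_subset that by blast
  have "(l \<in> O1) = (l \<in> O2)" if "l \<in> O1 \<union> O2" for l
    using c0[OF that] by (simp add: c_def split: if_splits)
  then show ?thesis
    by blast
qed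

text \<open>Evaluation on the whole coset of \<open>g\<close> separates the summands: at
  \<open>n \<otimes> g\<close> the same \<open>l\<close> are fixed and each summand is multiplied by
  \<open>l n\<close>, so independence on \<open>N\<close> applies to the coefficients.\<close>

lemma orbit_char_stabilizer:
  assumes "O1 \<in> dual_orbits" "\<mu> \<in> lin_chars G" "\<nu> \<in> lin_chars G"
    and trivial: "\<And>n. n \<in> N \<Longrightarrow> \<mu> n = 1" "\<And>n. n \<in> N \<Longrightarrow> \<nu> n = 1"
    and eq: "orbit_char O1 \<mu> = orbit_char O1 \<nu>"
    and "l \<in> O1" "g \<in> carrier G" "act g l = l"
  shows "\<mu> g = \<nu> g"
proof -
  let ?S = "{l \<in> O1. act g l = l}"
  let ?c = "\<lambda>l. l (F g) * (\<mu> g - \<nu> g)"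
  have S: "?S \<subseteq> lin_chars NN"
    using dual_orbit_subset[OF assms(1)] by blast
  have "(\<Sum>l\<in>?S. ?c l * l n) = 0" if n: "n \<in> N" for n
  proof -
    have "{l \<in> O1. act (n \<otimes> g) l = l} = ?S"
      using act_mult[of n g] act_N[OF n] act_closed[OF assms(8)] dual_orbit_subset[OF assms(1)] n assms(8)
      by auto
    moreover have "F (n \<otimes> g) = n \<otimes> F g"
      using n assms(8) by (simp add: F_mult F_N conj_N_trivial)
    moreover have "l (n \<otimes> F g) = l n * l (F g)" if "l \<in> ?S" for l
      using dual.lin_char_mult[of l n "F g"] S that n assms(8) by auto
    moreover have "\<mu> (n \<otimes> g) = \<mu> g" "\<nu> (n \<otimes> g) = \<nu> g"
      using lin_char_mult[OF assms(2)] lin_char_mult[OF assms(3)] trivial n assms(8) by simp_all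
    ultimately have "(\<Sum>l\<in>?S. l n * l (F g) * \<mu> g) = (\<Sum>l\<in>?S. l n * l (F g) * \<nu> g)"
      using fun_cong[OF eq, of "n \<otimes> g"] n assms(8) by (simp add: orbit_char_def)
    then show ?thesis
      by (simp add: algebra_simps sum_subtractf)
  qed
  then have "?c l = 0"
    using dual.lin_chars_independent[of ?S ?c l] S assms(7,9) by blast
  moreover have "l (F g) \<noteq> 0"
    using dual.lin_char_nonzero[of l "F g"] dual_orbit_subset[OF assms(1)] assms(7,8) by auto
  ultimately show ?thesis
    by simp
qed

text \<open>All \<open>\<mu>\<close> with the same \<open>orbit_char O1 \<mu>\<close> agree on the
  stabilizer of a point, whose index is \<open>card O1\<close>. By
  \<open>card_lin_chars_agreeing\<close> there are at most \<open>card O1\<close> of them.\<close>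

lemma card_orbit_chars:
  assumes "O1 \<in> dual_orbits" and trivial: "\<And>\<mu> n. \<mu> \<in> lin_chars G \<Longrightarrow> n \<in> N \<Longrightarrow> \<mu> n = 1"
  shows "card (lin_chars G) \<le> card (orbit_char O1 ` lin_chars G) * card O1"
proof -
  obtain l where l: "l \<in> lin_chars NN" and O1_eq: "O1 = orbit G dual_action l"
    using assms(1) by (auto simp: orbits_def)
  then have lO: "l \<in> O1"
    using dual_action.orbit_refl by blast
  let ?T = "stabilizer G dual_action l"
  have T: "?T \<subseteq> carrier G" "\<And>x. x \<in> ?T \<Longrightarrow> act x l = l"
    using l by (auto simp: stabilizer_def dual_action_def)
  have "\<one> \<in> ?T"
    using l by (simp add: stabilizer_def dual_action_def act_one)
  then have cT: "card ?T > 0"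
    using T(1) fin finite_subset by (auto simp: card_gt_0_iff)
  have "card {\<mu> \<in> lin_chars G. orbit_char O1 \<mu> = \<chi>} \<le> card O1" for \<chi>
  proof -
    have "card {\<mu> \<in> lin_chars G. orbit_char O1 \<mu> = \<chi>} * card ?T \<le> Coset.order G"
    proof (rule card_lin_chars_agreeing)
      show "\<mu> x = \<nu> x" if "\<mu> \<in> {\<mu> \<in> lin_chars G. orbit_char O1 \<mu> = \<chi>}"
        "\<nu> \<in> {\<mu> \<in> lin_chars G. orbit_char O1 \<mu> = \<chi>}" "x \<in> ?T" for \<mu> \<nu> x
      proof (rule orbit_char_stabilizer[OF assms(1) _ _ trivial trivial _ lO])
        show "act x l = l" "x \<in> carrier G"
          using that(3) T by auto
      qed (use that in auto)
    qed (use T in auto)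
    also have "\<dots> = card O1 * card ?T"
      using dual_action.orbit_stabilizer_theorem[OF l] by (simp add: O1_eq)
    finally show ?thesis
      using cT by simp
  qed
  then have "(\<Sum>\<chi>\<in>orbit_char O1 ` lin_chars G. card {\<mu> \<in> lin_chars G. orbit_char O1 \<mu> = \<chi>})
      \<le> card (orbit_char O1 ` lin_chars G) * card O1"
    using sum_bounded_above[of "orbit_char O1 ` lin_chars G" _ "card O1"] by simp
  moreover have "card (lin_chars G) =
      (\<Sum>\<chi>\<in>orbit_char O1 ` lin_chars G. card {\<mu> \<in> lin_chars G. orbit_char O1 \<mu> = \<chi>})"
    using finite_lin_chars by (subst card_eq_sum, subst sum.image_gen[of _ _ "orbit_char O1"]) auto
  ultimately show ?thesis
    by simp
qed

end

section \<open>Counting characters of degree prime to \<open>p\<close>\<close>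

context finite_group
begin

lemma pow_mem_subgroup:
  assumes "subgroup M G" "x \<in> M"
  shows "x [^] (k::nat) \<in> M"
  using assms by (induction k) (simp_all add: subgroup.one_closed subgroup.m_closed)

text \<open>Since \<open>k\<close> is invertible modulo \<open>p\<close>, the element
  \<open>x\<close> is a power of \<open>x [^] k\<close>.\<close>

lemma coprime_pow_mem_subgroup:
  assumes "subgroup M G" "x \<in> carrier G" "x [^] (p::nat) = \<one>" "coprime k p" "x [^] k \<in> M"
  shows "x \<in> M"
proof -
  obtain k' where "[k * k' = 1] (mod p)"
    using cong_solve_coprime_nat[OF assms(4)] by auto
  then obtain q1 q2 where q: "1 + q1 * p = k * k' + q2 * p"
    unfolding cong_iff_lin_nat by blast
  have "x [^] (q * p) = \<one>" for q :: nat
    using assms(2,3) by (subst mult.commute) (simp add: nat_pow_pow[symmetric])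
  then have pow: "x [^] (a + q * p) = x [^] a" for a q :: nat
    using assms(2) by (simp add: nat_pow_mult[symmetric])
  have "x = x [^] (1 + q1 * p)"
    using assms(2) unfolding pow by simp
  also have "\<dots> = (x [^] k) [^] k'"
    using assms(2) unfolding q pow by (simp add: nat_pow_pow)
  finally have "x = (x [^] k) [^] k'" .
  then show ?thesis
    using pow_mem_subgroup[OF assms(1,5), of k'] by simp
qed

text \<open>A maximal proper subgroup \<open>M\<close> has index \<open>p\<close>; the character sends \<open>m \<otimes> x [^] i\<close> to \<open>\<zeta> ^ i\<close>
  for fixed \<open>x \<notin> M\<close> and \<open>\<zeta> \<noteq> 1\<close> with \<open>\<zeta> ^ p = 1\<close>.\<close>

lemma nontrivial_lin_char_exists:
  assumes "prime p" and comm: "\<And>x y. x \<in> carrier G \<Longrightarrow> y \<in> carrier G \<Longrightarrow> x \<otimes> y = y \<otimes> x"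
    and exponent: "\<And>x. x \<in> carrier G \<Longrightarrow> x [^] (p::nat) = \<one>" and "carrier G \<noteq> {\<one>}"
  shows "\<exists>l\<in>lin_chars G. \<exists>x\<in>carrier G. l x \<noteq> 1"
proof -
  interpret C: comm_group G
    by (rule group_comm_groupI) (rule comm)
  define S where "S = {M. subgroup M G \<and> M \<noteq> carrier G}"
  have "finite S"
    by (rule finite_subset[of _ "Pow (carrier G)"]) (use fin subgroup.subset in \<open>auto simp: S_def\<close>)
  moreover have "{\<one>} \<in> S"
    using assms(4) triv_subgroup by (auto simp: S_def)
  ultimately obtain M where M: "M \<in> S" "Max (card ` S) = card M"
    using obtains_MAX[of S card] by (metis empty_iff)
  have max: "card M' \<le> card M" if "M' \<in> S" for M'
    using Max_ge[of "card ` S" "card M'"] \<open>finite S\<close> that M(2) by simp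
  from M interpret M: subgroup M G
    by (simp add: S_def)
  obtain x where x: "x \<in> carrier G" "x \<notin> M"
    using M M.subset by (auto simp: S_def)
  define M' where "M' = {m \<otimes> x [^] i | m (i::nat). m \<in> M}"
  have mM': "m \<otimes> x [^] i \<in> M'" if "m \<in> M" for m and i :: nat
    using that by (auto simp: M'_def)
  have mult: "(m \<otimes> x [^] i) \<otimes> (m' \<otimes> x [^] j) = (m \<otimes> m') \<otimes> x [^] (i + j)"
    if "m \<in> M" "m' \<in> M" for m m' and i j :: nat
    using that x by (simp add: nat_pow_mult[symmetric] C.m_ac)
  have "subgroup M' G"
  proof (rule subgroupI)
    show "M' \<subseteq> carrier G"
      using x by (auto simp: M'_def)
    show "M' \<noteq> {}"
      using mM' M.one_closed by blast
    show "a \<otimes> b \<in> M'" if "a \<in> M'" "b \<in> M'" for a b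
      using that mult mM' unfolding M'_def by (smt (verit) M.m_closed mem_Collect_eq)
    show "inv a \<in> M'" if aM': "a \<in> M'" for a
    proof -
      obtain m and i :: nat where a: "m \<in> M" "a = m \<otimes> x [^] i"
        using aM' by (auto simp: M'_def)
      have "i + (p - 1) * i = p * i"
        using prime_gt_0_nat[OF assms(1)] by (cases p) auto
      then have "x [^] i \<otimes> x [^] ((p - 1) * i) = (x [^] p) [^] i"
        using x by (simp add: nat_pow_mult nat_pow_pow)
      then have "x [^] i \<otimes> x [^] ((p - 1) * i) = \<one>"
        using x exponent by simp
      then have "inv (x [^] i) = x [^] ((p - 1) * i)"
        using x by (intro inv_equality) (simp_all add: C.m_comm)
      then have "inv a = inv m \<otimes> x [^] ((p - 1) * i)"
        using a x by (simp add: C.inv_mult)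
      then show ?thesis
        using mM' a by simp
    qed
  qed
  moreover have "M \<subset> M'"
    using mM'[of _ 0] mM'[of \<one> 1] x M.mem_carrier by force
  then have "card M < card M'"
    by (rule psubset_card_mono[rotated])
      (rule finite_subset[OF subgroup.subset[OF \<open>subgroup M' G\<close>] fin])
  ultimately have M'_eq: "M' = carrier G"
    using max[of M'] by (force simp: S_def)
  have "card {z::complex. z ^ p = 1} = p"
    using prime_gt_0_nat[OF assms(1)] by (rule card_roots_unity_eq)
  then have "\<not> {z::complex. z ^ p = 1} \<subseteq> {1}"
    using prime_gt_1_nat[OF assms(1)] card_mono[of "{1::complex}" "{z. z ^ p = 1}"] by auto
  then obtain \<zeta> :: complex where \<zeta>: "\<zeta> ^ p = 1" "\<zeta> \<noteq> 1"
    by blast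
  have wd: "\<zeta> ^ i = \<zeta> ^ j"
    if m: "m \<in> M" "m' \<in> M" and eq: "m \<otimes> x [^] i = m' \<otimes> x [^] j" for m m' and i j :: nat
  proof -
    \<comment> \<open>\<open>(p - 1) * j\<close> stands for the negative of \<open>j\<close> modulo
      \<open>p\<close>, so \<open>?k\<close> plays the role of \<open>i - j\<close> in the natural
      numbers.\<close>
    let ?k = "i + (p - 1) * j"
    have pj: "j + (p - 1) * j = p * j"
      using prime_gt_0_nat[OF assms(1)] by (cases p) auto
    have "m \<otimes> x [^] ?k = m' \<otimes> x [^] (j + (p - 1) * j)"
      using arg_cong[OF eq, of "\<lambda>y. y \<otimes> x [^] ((p - 1) * j)"] m x by (simp add: m_assoc nat_pow_mult)
    also have "\<dots> = m'"
      unfolding pj using x m exponent by (simp add: nat_pow_pow[symmetric])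
    finally have "x [^] ?k = inv m \<otimes> m'"
      using m x inv_solve_left'[of "x [^] ?k" m m'] by simp
    then have "x [^] ?k \<in> M"
      using m by simp
    then have "\<not> coprime ?k p"
      using coprime_pow_mem_subgroup[OF M.subgroup_axioms x(1) exponent[OF x(1)]] x(2) by blast
    then have "p dvd ?k"
      using assms(1) by (metis coprime_commute prime_imp_coprime)
    then obtain q where kq: "?k = p * q" ..
    have pq: "\<zeta> ^ (p * q) = 1" for q
      by (simp add: power_mult \<zeta>(1))
    have "\<zeta> ^ i * \<zeta> ^ ((p - 1) * j) = 1"
      by (simp only: power_add[symmetric] kq pq)
    moreover have "\<zeta> ^ j * \<zeta> ^ ((p - 1) * j) = 1"
      by (simp only: power_add[symmetric] pj pq)
    ultimately show ?thesis
      by (metis mult_cancel_right mult_zero_right zero_neq_one)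
  qed
  define l where "l = (\<lambda>y\<in>carrier G. \<zeta> ^ (SOME i::nat. \<exists>m\<in>M. y = m \<otimes> x [^] i))"
  have l: "l (m \<otimes> x [^] i) = \<zeta> ^ i" if m: "m \<in> M" for m and i :: nat
  proof -
    let ?P = "\<lambda>j::nat. \<exists>m'\<in>M. m \<otimes> x [^] i = m' \<otimes> x [^] j"
    have "?P (SOME j. ?P j)"
      by (rule someI[of ?P i]) (use m in blast)
    then obtain m' where "m' \<in> M" "m \<otimes> x [^] i = m' \<otimes> x [^] (SOME j. ?P j)"
      by blast
    from wd[OF m this] have "\<zeta> ^ (SOME j. ?P j) = \<zeta> ^ i"
      by (rule sym)
    then show ?thesis
      using m x by (simp add: l_def)
  qed
  have "l \<in> lin_chars G"
    unfolding lin_chars_def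
  proof (intro CollectI conjI ballI)
    show "l \<one> = 1"
      using l[of \<one> 0] by simp
    fix a b assume "a \<in> carrier G" "b \<in> carrier G"
    then obtain m i m' j where "m \<in> M" "a = m \<otimes> x [^] (i::nat)" "m' \<in> M" "b = m' \<otimes> x [^] (j::nat)"
      unfolding M'_eq[symmetric] M'_def by blast
    then show "l (a \<otimes> b) = l a * l b"
      by (simp add: mult l power_add)
  qed (simp add: l_def)
  moreover have "l x = \<zeta>"
    using l[of \<one> 1] x by simp
  ultimately show ?thesis
    using x \<zeta> by metis
qed

definition lin_char_group :: "('a \<Rightarrow> complex) monoid" where
  "lin_char_group = \<lparr>carrier = lin_chars G, monoid.mult = (\<lambda>\<mu> \<nu>. \<lambda>x\<in>carrier G. \<mu> x * \<nu> x),
     one = (\<lambda>x\<in>carrier G. 1)\<rparr>"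

lemma group_lin_char_group: "group lin_char_group"
proof (rule groupI)
  fix \<mu> assume "\<mu> \<in> carrier lin_char_group"
  then have \<mu>: "\<mu> \<in> lin_chars G"
    by (simp add: lin_char_group_def)
  then show "\<one>\<^bsub>lin_char_group\<^esub> \<otimes>\<^bsub>lin_char_group\<^esub> \<mu> = \<mu>"
    using mult_lin_char[OF one_lin_char \<mu>] by (intro lin_chars_eqI) (auto simp: lin_char_group_def)
  have "(\<lambda>x\<in>carrier G. (\<lambda>x\<in>carrier G. cnj (\<mu> x)) x * \<mu> x) = (\<lambda>x\<in>carrier G. 1)"
    using lin_char_cnj[OF \<mu>] by (auto simp: mult.commute intro!: restrict_ext)
  then show "\<exists>\<nu>\<in>carrier lin_char_group. \<nu> \<otimes>\<^bsub>lin_char_group\<^esub> \<mu> = \<one>\<^bsub>lin_char_group\<^esub>"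
    using cnj_lin_char[OF \<mu>] by (auto simp: lin_char_group_def intro!: bexI[of _ "\<lambda>x\<in>carrier G. cnj (\<mu> x)"])
qed (auto simp: lin_char_group_def one_lin_char mult_lin_char mult.assoc intro!: restrict_ext)

text \<open>A nontrivial character has order \<open>p\<close> in the dual group, so the divisibility
  is Lagrange's theorem there.\<close>

lemma prime_dvd_card_lin_chars:
  assumes "prime p" and exponent: "\<And>x. x \<in> carrier G \<Longrightarrow> x [^] p = \<one>"
    and l: "l \<in> lin_chars G" and nontriv: "\<exists>x\<in>carrier G. l x \<noteq> 1"
  shows "p dvd card (lin_chars G)"
proof -
  interpret L: group lin_char_group
    by (rule group_lin_char_group)
  have lL: "l \<in> carrier lin_char_group"
    using l by (simp add: lin_char_group_def)
  have pow: "(l [^]\<^bsub>lin_char_group\<^esub> k) x = l x ^ k" if "x \<in> carrier G" for x and k :: nat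
    using that by (induction k) (auto simp: lin_char_group_def L.nat_pow_Suc nat_pow_def mult.commute)
  have "l [^]\<^bsub>lin_char_group\<^esub> p = \<one>\<^bsub>lin_char_group\<^esub>"
  proof (rule lin_chars_eqI)
    show "l [^]\<^bsub>lin_char_group\<^esub> p \<in> lin_chars G" "\<one>\<^bsub>lin_char_group\<^esub> \<in> lin_chars G"
      using L.nat_pow_closed[OF lL] one_lin_char by (auto simp: lin_char_group_def)
    show "(l [^]\<^bsub>lin_char_group\<^esub> p) x = \<one>\<^bsub>lin_char_group\<^esub> x" if "x \<in> carrier G" for x
      using pow[OF that] lin_char_pow[OF l that, of p] exponent[OF that] lin_char_one[OF l] that
      by (simp add: lin_char_group_def)
  qed
  then have "L.ord l dvd p"
    using L.pow_eq_id[OF lL] by simp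
  moreover have "l \<noteq> \<one>\<^bsub>lin_char_group\<^esub>"
    using nontriv by (auto simp: lin_char_group_def)
  then have "L.ord l \<noteq> 1"
    using L.ord_eq_1[OF lL] by simp
  ultimately have "L.ord l = p"
    using assms(1) by (auto simp: prime_nat_iff)
  then show ?thesis
    using L.ord_dvd_group_order[OF lL] by (simp add: Coset.order_def lin_char_group_def)
qed

end

text \<open>The right side minus the left is \<open>(d - 2) (p + 1 - d)\<close> for
  \<open>d \<le> p - 1\<close> and \<open>4 d - 2 (p + 1)\<close> beyond. Equality at
  \<open>d = 2\<close> is the dihedral case. The truncation is forced by large orbits, because
  \<open>d * d\<close> outgrows a weight that is linear in \<open>d\<close>.\<close>

lemma degree_weight_bound:
  fixes p d :: nat
  assumes "p \<ge> 3" "d \<ge> 2"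
  shows "real d * min (real d) (real p - 1) \<le> (real p + 3) * real d - 2 * (real p + 1)"
proof (cases "real d \<le> real p - 1")
  case True
  then have "0 \<le> (real d - 2) * (real p + 1 - real d)"
    using assms by (intro mult_nonneg_nonneg) auto
  then show ?thesis
    using True by (simp add: algebra_simps min_def)
next
  case False
  have "real d * (real p - 1) \<le> (real p + 3) * real d - 2 * (real p + 1)"
    using False assms by (simp add: algebra_simps)
  then show ?thesis
    using False by (simp add: min_def)
qed

lemma degree_weight_nonneg:
  fixes p d :: nat
  assumes "d \<ge> 2"
  shows "0 \<le> (real p + 3) * real d - 2 * (real p + 1)"
proof -
  have "(real p + 3) * 2 \<le> (real p + 3) * real d"
    using assms by (intro mult_left_mono) auto
  then show ?thesis
    by simp
qed

text \<open>Either one term alone reaches \<open>c\<close>, or nothing is truncated. Thus a total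
  orbit size of at least \<open>p - 1\<close> survives the truncation in
  \<open>degree_weight_bound\<close>.\<close>

lemma sum_min_ge:
  fixes f :: "'a \<Rightarrow> real"
  assumes "finite A" "c \<le> sum f A" "c \<ge> 0" "\<And>x. x \<in> A \<Longrightarrow> f x \<ge> 0"
  shows "c \<le> (\<Sum>x\<in>A. min (f x) c)"
proof (cases "\<exists>x\<in>A. f x \<ge> c")
  case True
  then obtain x where "x \<in> A" and "c \<le> min (f x) c"
    by auto
  moreover have "min (f x) c \<le> (\<Sum>x\<in>A. min (f x) c)"
    using assms \<open>x \<in> A\<close> by (intro member_le_sum) auto
  ultimately show ?thesis
    by linarith
next
  case False
  then have "(\<Sum>x\<in>A. min (f x) c) = sum f A"
    by (intro sum.cong) auto
  then show ?thesis
    using assms by simp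
qed

context split_extension
begin

lemma sum_p'_orbits_ge:
  assumes "prime p" and exponent: "\<And>n. n \<in> N \<Longrightarrow> n [^] p = \<one>" and "N \<noteq> {\<one>}"
  shows "p - 1 \<le> (\<Sum>O1\<in>{O1 \<in> dual_orbits. \<not> p dvd card O1 \<and> (\<lambda>n\<in>N. 1) \<notin> O1}. card O1)"
proof -
  let ?t = "\<lambda>n\<in>N. 1 :: complex"
  have "\<exists>l\<in>lin_chars NN. \<exists>n\<in>N. l n \<noteq> 1"
    using dual.nontrivial_lin_char_exists[OF assms(1)] abelian exponent assms(3) by simp
  then have p_dvd: "p dvd card (lin_chars NN)"
    using dual.prime_dvd_card_lin_chars[OF assms(1)] exponent by auto
  have finD: "finite dual_orbits"
    using dual.finite_lin_chars by (simp add: orbits_def)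
  have "card (lin_chars NN) = (\<Sum>O1\<in>dual_orbits. card O1)"
    using dual_action.disjoint_sum[OF dual.finite_lin_chars, of "\<lambda>_. 1::nat"] by simp
  also have "\<dots> = (\<Sum>O1\<in>{O1 \<in> dual_orbits. p dvd card O1}. card O1) +
      (\<Sum>O1\<in>{O1 \<in> dual_orbits. \<not> p dvd card O1}. card O1)"
    using finD by (subst sum.union_disjoint[symmetric]) (auto intro: sum.cong)
  finally have "p dvd (\<Sum>O1\<in>{O1 \<in> dual_orbits. p dvd card O1}. card O1) +
      (\<Sum>O1\<in>{O1 \<in> dual_orbits. \<not> p dvd card O1}. card O1)"
    using p_dvd by simp
  moreover have "p dvd (\<Sum>O1\<in>{O1 \<in> dual_orbits. p dvd card O1}. card O1)"
    by (rule dvd_sum) simp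
  ultimately have dvd: "p dvd (\<Sum>O1\<in>{O1 \<in> dual_orbits. \<not> p dvd card O1}. card O1)"
    by (simp add: dvd_add_right_iff)
  have t: "?t \<in> lin_chars NN"
    using dual.one_lin_char .
  have "act g ?t = ?t" if "g \<in> carrier G" for g
    using that by (auto simp: act_def)
  then have "orbit G dual_action ?t = {?t}"
    using orbit_dual[OF t] one_closed by auto
  then have t_orbit: "{?t} \<in> dual_orbits"
    using t by (force simp: orbits_def)
  have single: "O1 = {?t}" if "O1 \<in> dual_orbits" "?t \<in> O1" for O1
    using dual_action.disjoint_union[OF that(1) t_orbit] that(2) by blast
  have "\<not> p dvd card {?t}"
    using prime_gt_1_nat[OF assms(1)] by simp
  then have "{O1 \<in> dual_orbits. \<not> p dvd card O1} =
      insert {?t} {O1 \<in> dual_orbits. \<not> p dvd card O1 \<and> ?t \<notin> O1}"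
    using t_orbit single by blast
  then have "(\<Sum>O1\<in>{O1 \<in> dual_orbits. \<not> p dvd card O1}. card O1) =
      1 + (\<Sum>O1\<in>{O1 \<in> dual_orbits. \<not> p dvd card O1 \<and> ?t \<notin> O1}. card O1)"
    using finD by simp
  \<comment> \<open>With the trivial orbit included the sum is positive and divisible by
    \<open>p\<close>, hence at least \<open>p\<close>; the trivial character accounts for 1.\<close>
  with dvd show ?thesis
    by (auto dest!: dvd_imp_le)
qed

lemma sum_degree_weight_nonneg:
  assumes "prime p" "odd p" and exponent: "\<And>n. n \<in> N \<Longrightarrow> n [^] p = \<one>" and "N \<noteq> {\<one>}"
    and trivial: "\<And>\<mu> n. \<mu> \<in> lin_chars G \<Longrightarrow> n \<in> N \<Longrightarrow> \<mu> n = 1"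
    and moved: "\<And>l. l \<in> lin_chars NN \<Longrightarrow> l \<noteq> (\<lambda>n\<in>N. 1) \<Longrightarrow> \<exists>g\<in>carrier G. act g l \<noteq> l"
  shows "0 \<le> (\<Sum>\<chi>\<in>Irr_p' p G. (real p + 3) * real (char_degree G \<chi>) - 2 * (real p + 1))"
proof -
  define w where "w d = (real p + 3) * real d - 2 * (real p + 1)" for d :: nat
  define P where "P = {O1 \<in> dual_orbits. \<not> p dvd card O1 \<and> (\<lambda>n\<in>N. 1) \<notin> O1}"
  define S where "S O1 = orbit_char O1 ` lin_chars G" for O1
  have p3: "p \<ge> 3"
    using prime_ge_2_nat[OF assms(1)] assms(2) by (cases "p = 2") auto
  have finP: "finite P"
    using dual.finite_lin_chars by (simp add: P_def orbits_def)
  have finS: "finite (S O1)" for O1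
    using finite_lin_chars by (simp add: S_def)
  have P_orbit: "O1 \<in> dual_orbits" if "O1 \<in> P" for O1
    using that by (simp add: P_def)
  have card_P: "card O1 \<ge> 2" if O1: "O1 \<in> P" for O1
  proof -
    obtain l where l: "l \<in> lin_chars NN" and "O1 = orbit G dual_action l"
      using P_orbit[OF O1] by (auto simp: orbits_def)
    then have lO: "l \<in> O1"
      using dual_action.orbit_refl by blast
    then have "l \<noteq> (\<lambda>n\<in>N. 1)"
      using O1 by (auto simp: P_def)
    then obtain g where "g \<in> carrier G" "act g l \<noteq> l"
      using moved l by blast
    then have "card {l, act g l} = 2" "{l, act g l} \<subseteq> O1"
      using lO act_dual_orbit[OF P_orbit[OF O1]] by auto
    then show ?thesis
      using card_mono[OF finite_dual_orbit[OF P_orbit[OF O1]]] by metis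
  qed
  have S_Irr: "\<chi> \<in> Irr G" "char_degree G \<chi> = card O1" if "\<chi> \<in> S O1" "O1 \<in> P" for \<chi> O1
    using that orbit_char_Irr[OF P_orbit[OF that(2)] _ trivial] by (auto simp: S_def)
  have S_card: "real (card (lin_chars G)) * min (real (card O1)) (real p - 1) \<le> real (card (S O1)) * w (card O1)"
    if O1: "O1 \<in> P" for O1
  proof -
    let ?m = "min (real (card O1)) (real p - 1)"
    have "card (lin_chars G) \<le> card (S O1) * card O1"
      unfolding S_def using card_orbit_chars[OF P_orbit[OF O1]] trivial by blast
    then have "real (card (lin_chars G)) \<le> real (card (S O1) * card O1)"
      by (simp only: of_nat_le_iff)
    \<comment> \<open>The orbit size lost in counting characters reappears as the factor
      \<open>d\<close> in \<open>degree_weight_bound\<close>.\<close>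
    then have "real (card (lin_chars G)) * ?m \<le> real (card (S O1) * card O1) * ?m"
      by (rule mult_right_mono) (use p3 in simp)
    also have "\<dots> = real (card (S O1)) * (real (card O1) * ?m)"
      by simp
    also have "\<dots> \<le> real (card (S O1)) * w (card O1)"
      unfolding w_def using degree_weight_bound[OF p3 card_P[OF O1]] by (intro mult_left_mono) auto
    finally show ?thesis .
  qed
  let ?L = "lin_chars G"
  have fin_Irr: "finite (Irr_p' p G)"
    using finite_Irr by (simp add: Irr_p'_def)
  have L_sub: "?L \<subseteq> Irr_p' p G"
    using lin_char_Irr prime_gt_1_nat[OF assms(1)] by (auto simp: Irr_p'_def)
  have S_sub: "(\<Union>O1\<in>P. S O1) \<subseteq> Irr_p' p G - ?L"
  proof
    fix \<chi> assume "\<chi> \<in> (\<Union>O1\<in>P. S O1)"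
    then obtain O1 where O1: "O1 \<in> P" "\<chi> \<in> S O1"
      by blast
    then show "\<chi> \<in> Irr_p' p G - ?L"
      using S_Irr[OF O1(2,1)] card_P[OF O1(1)] lin_char_Irr(2)[of \<chi>] by (auto simp: Irr_p'_def P_def)
  qed
  have w_nonneg: "0 \<le> w (char_degree G \<chi>)" if "\<chi> \<in> Irr_p' p G - ?L" for \<chi>
  proof -
    have "char_degree G \<chi> \<noteq> 1" "char_degree G \<chi> > 0"
      using that degree_one_lin_char char_degree_pos by (auto simp: Irr_p'_def)
    then show ?thesis
      unfolding w_def by (intro degree_weight_nonneg) linarith
  qed
  have disj: "S O1 \<inter> S O2 = {}" if "O1 \<in> P" "O2 \<in> P" "O1 \<noteq> O2" for O1 O2
    using that orbit_char_inj_orbit[OF P_orbit[OF that(1)] P_orbit[OF that(2)] trivial trivial]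
    by (auto simp: S_def)
  have orbits_ge: "real p - 1 \<le> (\<Sum>O1\<in>P. real (card O1))"
    using sum_p'_orbits_ge[OF assms(1) exponent assms(4)] p3
    unfolding P_def by (simp flip: of_nat_sum)
  have "real (card ?L) * (real p - 1) \<le> real (card ?L) * (\<Sum>O1\<in>P. min (real (card O1)) (real p - 1))"
    using orbits_ge p3 finP by (intro mult_left_mono sum_min_ge) auto
  also have "\<dots> \<le> (\<Sum>O1\<in>P. real (card (S O1)) * w (card O1))"
    unfolding sum_distrib_left using S_card by (intro sum_mono) auto
  also have "\<dots> = (\<Sum>O1\<in>P. \<Sum>\<chi>\<in>S O1. w (char_degree G \<chi>))"
    using S_Irr(2) by (intro sum.cong) auto
  also have "\<dots> = (\<Sum>\<chi>\<in>(\<Union>O1\<in>P. S O1). w (char_degree G \<chi>))"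
    using finP finS disj by (intro sum.UNION_disjoint[symmetric]) auto
  \<comment> \<open>The remaining nonlinear characters have nonnegative weight and may be
    added.\<close>
  also have "\<dots> \<le> (\<Sum>\<chi>\<in>Irr_p' p G - ?L. w (char_degree G \<chi>))"
    using fin_Irr S_sub w_nonneg by (intro sum_mono2) auto
  finally have "real (card ?L) * (real p - 1) \<le> (\<Sum>\<chi>\<in>Irr_p' p G - ?L. w (char_degree G \<chi>))" .
  moreover have "(\<Sum>\<chi>\<in>?L. w (char_degree G \<chi>)) = - real (card ?L) * (real p - 1)"
    using lin_char_Irr(2) by (simp add: w_def algebra_simps)
  moreover have "(\<Sum>\<chi>\<in>Irr_p' p G. w (char_degree G \<chi>)) =
      (\<Sum>\<chi>\<in>Irr_p' p G - ?L. w (char_degree G \<chi>)) + (\<Sum>\<chi>\<in>?L. w (char_degree G \<chi>))"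
    using fin_Irr L_sub by (rule sum.subset_diff[rotated])
  ultimately show ?thesis
    by (simp add: w_def)
qed

end

section \<open>Reduction to a split extension\<close>

text \<open>\<open>G / M\<close> is \<open>p\<close>-nilpotent, stated inside \<open>G\<close>: \<open>H / M\<close> is the normal \<open>p\<close>-complement.\<close>

definition p_nilpotent_mod :: "nat \<Rightarrow> ('a, 'b) monoid_scheme \<Rightarrow> 'a set \<Rightarrow> bool" where
  "p_nilpotent_mod p G M \<longleftrightarrow> (\<exists>H m k. H \<lhd> G \<and> M \<subseteq> H \<and> card H = m * card M \<and> coprime m p \<and>
     Coset.order G = card H * p ^ k)"

lemma p_nilpotent_modI:
  "H \<lhd> G \<Longrightarrow> M \<subseteq> H \<Longrightarrow> card H = m * card M \<Longrightarrow> coprime m p \<Longrightarrow> Coset.order G = card H * p ^ k \<Longrightarrow>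
    p_nilpotent_mod p G M"
  unfolding p_nilpotent_mod_def by blast

context finite_group
begin

lemma p_nilpotent_mod_one:
  assumes "p_nilpotent_mod p G {\<one>}"
  shows "p_nilpotent p G"
proof -
  obtain H k where H: "H \<lhd> G" "coprime (card H) p" "Coset.order G = card H * p ^ k"
    using assms by (auto simp: p_nilpotent_mod_def)
  have "card (rcosets H) * card H = p ^ k * card H"
    using lagrange[OF normal_imp_subgroup[OF H(1)]] H(3) by (simp add: mult.commute)
  moreover have "card H \<noteq> 0"
    using H(3) order_pos by auto
  ultimately have "card (rcosets H) = p ^ k"
    by simp
  then show ?thesis
    using H unfolding p_nilpotent_def by blast
qed

lemma p_nilpotent_mod_carrier: "p_nilpotent_mod p G (carrier G)"
  by (rule p_nilpotent_modI[of "carrier G" _ _ 1 _ 0]) (simp_all add: normal_self Coset.order_def)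

lemma cauchy:
  assumes "prime q" "q dvd Coset.order G"
  shows "\<exists>x\<in>carrier G. x \<noteq> \<one> \<and> x [^] q = \<one>"
proof -
  \<comment> \<open>The cofactor \<open>m\<close> in the Sylow theorem may still be divisible by
    \<open>q\<close>, so exponent 1 yields a subgroup of order exactly \<open>q\<close>.\<close>
  obtain m where "Coset.order G = q ^ 1 * m"
    using assms(2) by auto
  then obtain P where P: "subgroup P G" "card P = q ^ 1"
    using sylow_thm[OF assms(1) is_group _ fin] by metis
  then interpret P: finite_group "G\<lparr>carrier := P\<rparr>"
    by (intro finite_group.intro finite_group_axioms.intro subgroup.subgroup_is_group is_group)
      (auto intro: finite_subset[OF subgroup.subset fin])
  have "P \<noteq> {\<one>}"
    using P(2) prime_gt_1_nat[OF assms(1)] by auto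
  then obtain x where x: "x \<in> P" "x \<noteq> \<one>"
    using subgroup.one_closed[OF P(1)] by blast
  then have "x [^] q = \<one>"
    using P.pow_order_eq_1[of x] P(2) by (simp add: Coset.order_def nat_pow_consistent[symmetric])
  then show ?thesis
    using x subgroup.mem_carrier[OF P(1)] by blast
qed

lemma order_prime_power:
  assumes "prime p" "\<And>x. x \<in> carrier G \<Longrightarrow> x [^] p = \<one>"
  shows "\<exists>j. Coset.order G = p ^ j"
proof (rule ccontr)
  assume "\<nexists>j. Coset.order G = p ^ j"
  then obtain q where q: "q \<in> prime_factors (Coset.order G)" "q \<noteq> p"
    using Ex_other_prime_factor[of "Coset.order G" p] assms(1) order_pos by auto
  then obtain x where x: "x \<in> carrier G" "x \<noteq> \<one>" "x [^] q = \<one>"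
    using cauchy[of q] by (auto simp: in_prime_factors_iff)
  have "coprime q p"
    using q assms(1) by (intro primes_coprime) (auto simp: in_prime_factors_iff)
  then have "x \<in> {\<one>}"
    using coprime_pow_mem_subgroup[OF triv_subgroup x(1) assms(2)[OF x(1)]] x(3) by simp
  then show False
    using x by simp
qed

lemma lin_char_derived:
  assumes "\<mu> \<in> lin_chars G" "x \<in> derived G (carrier G)"
  shows "\<mu> x = 1"
proof -
  let ?K = "{x \<in> carrier G. \<mu> x = 1}"
  have "subgroup ?K G"
  proof (rule subgroupI)
    show "inv a \<in> ?K" if "a \<in> ?K" for a
      using that lin_char_inv_mult[OF assms(1), of a] by simp
  qed (use assms(1) in \<open>auto simp: lin_char_mult lin_char_one intro!: exI[of _ \<one>]\<close>)
  moreover have "derived_set G (carrier G) \<subseteq> ?K"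
  proof
    fix y assume "y \<in> derived_set G (carrier G)"
    then obtain a b where ab: "a \<in> carrier G" "b \<in> carrier G" "y = a \<otimes> b \<otimes> inv a \<otimes> inv b"
      by auto
    then have "\<mu> y = (\<mu> (inv a) * \<mu> a) * (\<mu> (inv b) * \<mu> b)"
      using assms(1) by (simp add: lin_char_mult)
    then show "y \<in> ?K"
      using ab assms(1) by (simp add: lin_char_inv_mult)
  qed
  ultimately show ?thesis
    using assms(2) generate_subgroup_incl unfolding derived_def by blast
qed

end

context abelian_normal
begin

lemma finite_group_NN: "finite_group NN"
  by (intro finite_group.intro finite_group_axioms.intro N.is_group) (simp add: finN)

lemma exponent_normal: "{x \<in> N. x [^] (p::nat) = \<one>} \<lhd> G"
  unfolding normal_inv_iff
proof (intro conjI ballI)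
  show "subgroup {x \<in> N. x [^] p = \<one>} G"
    by (rule subgroupI) (auto simp: N_pow_mult nat_pow_inv intro!: exI[of _ \<one>])
  fix g x assume "g \<in> carrier G" "x \<in> {x \<in> N. x [^] p = \<one>}"
  then have "conj g x \<in> N" "conj g x [^] p = \<one>"
    using conj_pow[of g x p] by auto
  then show "g \<otimes> x \<otimes> inv g \<in> {x \<in> N. x [^] p = \<one>}"
    by (simp add: conj_def)
qed

end

context coprime_extension
begin

lemma centralizer_normal: "{b \<in> N. \<forall>x\<in>H. conj x b = b} \<lhd> G"
  unfolding normal_inv_iff
proof (intro conjI ballI)
  show "subgroup {b \<in> N. \<forall>x\<in>H. conj x b = b} G"
    by (rule subgroupI) (auto simp: conj_mult conj_inv intro!: exI[of _ \<one>])
  fix g b assume g: "g \<in> carrier G" and b: "b \<in> {b \<in> N. \<forall>x\<in>H. conj x b = b}"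
  have "conj x (conj g b) = conj g b" if x: "x \<in> H" for x
  proof -
    have "b \<in> N" "g \<otimes> conj (inv g) x = x \<otimes> g"
      using x g b by (simp_all add: conj_def m_assoc)
    then have "conj x (conj g b) = conj g (conj (conj (inv g) x) b)"
      using x g by (simp add: conj_conj)
    also have "conj (conj (inv g) x) b = b"
      using b x g by simp
    finally show ?thesis .
  qed
  then show "g \<otimes> b \<otimes> inv g \<in> {b \<in> N. \<forall>x\<in>H. conj x b = b}"
    using g b conj_N[of g b] by (simp add: conj_def)
qed

end

context finite_group
begin

text \<open>A minimal normal subgroup \<open>N\<close> inside \<open>A\<close> is elementary abelian of exponent \<open>p\<close>, and \<open>H / N\<close>,
  the \<open>p\<close>-complement of \<open>G / N\<close>, has no nontrivial fixed points on \<open>N\<close>: otherwise it would fix \<open>N\<close>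
  pointwise, and the complement of \<open>N\<close> in \<open>H\<close> would be a normal \<open>p\<close>-complement of \<open>G\<close>.\<close>

lemma split_extension_exists:
  assumes "prime p" and A: "A \<lhd> G" "A \<noteq> {\<one>}" and comm: "\<And>x y. x \<in> A \<Longrightarrow> y \<in> A \<Longrightarrow> x \<otimes> y = y \<otimes> x"
    and quot: "\<And>N. N \<lhd> G \<Longrightarrow> N \<noteq> {\<one>} \<Longrightarrow> N \<subseteq> A \<Longrightarrow> p_nilpotent_mod p G N"
    and not_nilp: "\<not> p_nilpotent_mod p G {\<one>}"
  shows "\<exists>N F. split_extension N G F \<and> N \<subseteq> A \<and> N \<noteq> {\<one>} \<and> (\<forall>n\<in>N. n [^] p = \<one>) \<and>
    (\<forall>N'. N' \<lhd> G \<longrightarrow> N' \<subseteq> N \<longrightarrow> N' = {\<one>} \<or> N' = N) \<and>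
    \<not> (\<forall>g\<in>carrier G. \<forall>n\<in>N. g \<otimes> n \<otimes> inv g = n)"
proof -
  define Q where "Q N \<longleftrightarrow> N \<lhd> G \<and> N \<noteq> {\<one>} \<and> N \<subseteq> A" for N
  have "Q A"
    using A by (simp add: Q_def)
  then obtain N where N: "Q N" and min: "\<And>N'. Q N' \<Longrightarrow> card N \<le> card N'"
    using ex_has_least_nat[of Q A card] by blast
  then have NA: "N \<lhd> G" "N \<noteq> {\<one>}" "N \<subseteq> A"
    by (simp_all add: Q_def)
  interpret abelian_normal N G
    using NA(1,3) comm
    by (intro abelian_normal.intro abelian_normal_axioms.intro finite_group_axioms) (auto simp: subset_eq)
  interpret NG: finite_group NN
    by (rule finite_group_NN)
  have minN: "N' = {\<one>} \<or> N' = N" if "N' \<lhd> G" "N' \<subseteq> N" for N'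
  proof (rule ccontr)
    assume "\<not> (N' = {\<one>} \<or> N' = N)"
    then have "Q N'" "N' \<subset> N"
      using that NA by (auto simp: Q_def)
    then show False
      using min[of N'] psubset_card_mono[OF finN, of N'] by simp
  qed
  obtain H m k where H: "H \<lhd> G" "N \<subseteq> H" "card H = m * card N" "coprime m p"
    and order: "Coset.order G = card H * p ^ k"
    using quot[OF NA] unfolding p_nilpotent_mod_def by blast
  have exponent: "n [^] p = \<one>" if n: "n \<in> N" for n
  proof -
    \<comment> \<open>Otherwise minimality leaves no element of order \<open>p\<close> in
      \<open>N\<close>; then \<open>H\<close> has order prime to \<open>p\<close> and is itself a
      normal \<open>p\<close>-complement of \<open>G\<close>.\<close>
    have "{x \<in> N. x [^] p = \<one>} = N"
    proof (rule ccontr)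
      assume "{x \<in> N. x [^] p = \<one>} \<noteq> N"
      then have E: "{x \<in> N. x [^] p = \<one>} = {\<one>}"
        using minN[OF exponent_normal] by auto
      have "\<not> p dvd card N"
      proof
        assume "p dvd card N"
        then obtain x where "x \<in> N" "x \<noteq> \<one>" "x [^] p = \<one>"
          using NG.cauchy[OF assms(1)] by (auto simp: Coset.order_def)
        then show False
          using E by blast
      qed
      then have "coprime (card N) p"
        using assms(1) by (metis coprime_commute prime_imp_coprime)
      then have "coprime (card H) p"
        using H by simp
      then have "p_nilpotent_mod p G {\<one>}"
        using H order subgroup.one_closed[OF normal_imp_subgroup[OF H(1)]]
        by (intro p_nilpotent_modI[of H _ _ "card H" _ k]) auto
      then show False
        using not_nilp by blast
    qed
    then show ?thesis
      using n by blast
  qed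
  interpret coprime_extension N H G p m
    using H exponent
    by (intro coprime_extension.intro coprime_extension_axioms.intro abelian_normal_axioms)
      (auto simp: subset_eq)
  have not_central: "\<not> (\<forall>n\<in>N. \<forall>x\<in>H. conj x n = n)"
  proof
    assume "\<forall>n\<in>N. \<forall>x\<in>H. conj x n = n"
    then obtain K where K: "K \<lhd> G" "card K = m"
      using central_complement by blast
    \<comment> \<open>As \<open>N\<close> is a \<open>p\<close>-group, replacing \<open>H\<close> by
      \<open>K\<close> multiplies the index by a power of \<open>p\<close> only.\<close>
    obtain j where "card N = p ^ j"
      using NG.order_prime_power[OF assms(1)] exponent by (auto simp: Coset.order_def)
    then have "Coset.order G = card K * p ^ (j + k)"
      using order H(3) K(2) by (simp add: power_add)
    then have "p_nilpotent_mod p G {\<one>}"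
      using K H(4) subgroup.one_closed[OF normal_imp_subgroup[OF K(1)]]
      by (intro p_nilpotent_modI[of K _ _ m _ "j + k"]) auto
    then show False
      using not_nilp by blast
  qed
  then have "{b \<in> N. \<forall>x\<in>H. conj x b = b} \<noteq> N"
    by blast
  then have "{b \<in> N. \<forall>x\<in>H. conj x b = b} = {\<one>}"
    using minN[OF centralizer_normal] by blast
  then obtain F where "crossed_hom (carrier G) F" "\<forall>n\<in>N. F n = n"
    using crossed_hom_extends by blast
  then have "split_extension N G F"
    by (intro split_extension.intro split_extension_axioms.intro abelian_normal_axioms) auto
  moreover have "\<not> (\<forall>g\<in>carrier G. \<forall>n\<in>N. g \<otimes> n \<otimes> inv g = n)"
    using not_central by (auto simp: conj_def)
  ultimately show ?thesis
    using NA exponent minN by blast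
qed

end

context split_extension
begin

text \<open>The kernel of a \<open>G\<close>-invariant character is normal in \<open>G\<close>, so
  by minimality a nontrivial one is injective on \<open>N\<close>. Invariance then forces
  \<open>conj g n = n\<close>, and \<open>N\<close> would be central.\<close>

lemma lin_char_moved:
  assumes minimal: "\<And>N'. N' \<lhd> G \<Longrightarrow> N' \<subseteq> N \<Longrightarrow> N' = {\<one>} \<or> N' = N"
    and noncentral: "\<not> (\<forall>g\<in>carrier G. \<forall>n\<in>N. g \<otimes> n \<otimes> inv g = n)"
    and l: "l \<in> lin_chars NN" "l \<noteq> (\<lambda>n\<in>N. 1)"
  shows "\<exists>g\<in>carrier G. act g l \<noteq> l"
proof (rule ccontr)
  assume "\<not> (\<exists>g\<in>carrier G. act g l \<noteq> l)"
  then have fixed: "act (inv g) l = l" if "g \<in> carrier G" for g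
    using that by simp
  have inv: "l (conj g n) = l n" if "g \<in> carrier G" "n \<in> N" for g n
    using fun_cong[OF fixed[OF that(1)], of n] that by (simp add: act_def)
  let ?K = "{n \<in> N. l n = 1}"
  have "?K \<lhd> G"
    unfolding normal_inv_iff
  proof (intro conjI ballI)
    show "subgroup ?K G"
    proof (rule subgroupI)
      show "inv a \<in> ?K" if "a \<in> ?K" for a
        using that dual.lin_char_mult[OF l(1), of "inv a" a] dual.lin_char_one[OF l(1)] by simp
    qed (use l(1) in \<open>auto simp: dual.lin_char_mult dual.lin_char_one intro!: exI[of _ \<one>]\<close>)
    show "g \<otimes> n \<otimes> inv g \<in> ?K" if "g \<in> carrier G" "n \<in> ?K" for g n
      using that inv[of g n] conj_N[of g n] by (simp add: conj_def)
  qed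
  moreover have "?K \<noteq> N"
  proof
    assume "?K = N"
    then have "l n = (\<lambda>n\<in>N. 1) n" if "n \<in> N" for n
      using that by auto
    then show False
      using dual.lin_chars_eqI[OF l(1) dual.one_lin_char] l(2) by blast
  qed
  ultimately have K: "?K = {\<one>}"
    using minimal[of ?K] by blast
  have "conj g n = n" if g: "g \<in> carrier G" and n: "n \<in> N" for g n
  proof -
    have "l (conj g n \<otimes> inv n) = l (n \<otimes> inv n)"
      using g n by (simp only: dual.lin_char_mult[OF l(1)] inv conj_N subgroup.m_inv_closed[OF is_subgroup])
    then have "conj g n \<otimes> inv n \<in> ?K"
      using g n dual.lin_char_one[OF l(1)] by simp
    then have "conj g n \<otimes> inv n \<otimes> n = n"
      unfolding K using n by simp
    then show ?thesis
      using g n by (simp add: m_assoc)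
  qed
  then show False
    using noncentral by (simp add: conj_def)
qed

end

section \<open>Passing to a quotient\<close>

context normal
begin

text \<open>A subgroup of \<open>G Mod H\<close> is a set of cosets whose union is its preimage in
  \<open>G\<close>; this moves orders between the two groups.\<close>

lemma card_Union_cosets:
  assumes "finite (carrier G)" "S \<subseteq> rcosets H"
  shows "card (\<Union>S) = card S * card H"
proof -
  have "finite (rcosets H)"
    using assms(1) by (simp add: RCOSETS_def)
  have "card H * card S = card (\<Union>S)"
  proof (rule card_partition)
    show "finite S"
      using assms(2) \<open>finite (rcosets H)\<close> finite_subset by blast
    show "finite (\<Union>S)"
      using assms(1) Union_mono[OF assms(2)] unfolding rcosets_part_G[OF is_subgroup]
      by (rule rev_finite_subset)
    show "card c = card H" if "c \<in> S" for c
      using card_cosets_equal[OF _ subset, of c] that assms(2) bij_betw_same_card by (metis subsetD)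
    show "c1 \<inter> c2 = {}" if "c1 \<in> S" "c2 \<in> S" "c1 \<noteq> c2" for c1 c2
      using rcos_disjoint[OF is_subgroup] that assms(2) by (auto simp: pairwise_def disjnt_def)
  qed
  then show ?thesis
    by (simp add: mult.commute)
qed

lemma carrier_Mod: "carrier (G Mod H) = rcosets H"
  by (simp add: FactGroup_def)

lemma order_Mod:
  assumes "finite (carrier G)"
  shows "Coset.order G = Coset.order (G Mod H) * card H"
  using lagrange[OF is_subgroup] by (simp add: Coset.order_def carrier_Mod)

lemma finite_group_Mod:
  assumes "finite (carrier G)"
  shows "finite_group (G Mod H)"
  using factorgroup_is_group assms
  by (intro finite_group.intro finite_group_axioms.intro) (simp_all add: carrier_FactGroup)

lemma image_normal_Mod:
  assumes "K \<lhd> G"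
  shows "(\<lambda>g. H #> g) ` K \<lhd> G Mod H"
  using normal.surj_hom_normal_subgroup[OF assms, of "G Mod H" "\<lambda>g. H #> g"]
    r_coset_hom_Mod factorgroup_is_group
  by (auto simp: group_hom_def group_hom_axioms_def carrier_FactGroup intro: is_group)

lemma Union_image_cosets:
  assumes "subgroup K G" "H \<subseteq> K"
  shows "\<Union>((\<lambda>g. H #> g) ` K) = K"
proof
  show "\<Union>((\<lambda>g. H #> g) ` K) \<subseteq> K"
    using assms subgroup.m_closed[OF assms(1)] by (auto simp: r_coset_def)
  show "K \<subseteq> \<Union>((\<lambda>g. H #> g) ` K)"
    using rcos_self[OF subgroup.mem_carrier[OF assms(1)] is_subgroup] by blast
qed

text \<open>The image of \<open>K\<close> in the quotient serves as the complement, since all orders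
  involved are divided by \<open>card H\<close>.\<close>

lemma p_nilpotent_mod_quotient:
  assumes "finite (carrier G)" and N: "N \<lhd> G Mod H" and "p_nilpotent_mod p G (\<Union>N)"
  shows "p_nilpotent_mod p (G Mod H) N"
proof -
  obtain K m k where K: "K \<lhd> G" "\<Union>N \<subseteq> K" "card K = m * card (\<Union>N)" "coprime m p"
    "Coset.order G = card K * p ^ k"
    using assms(3) unfolding p_nilpotent_mod_def by blast
  have sN: "N \<subseteq> rcosets H" and "H \<in> N"
    using subgroup.subset[OF normal_imp_subgroup[OF N]] subgroup.one_closed[OF normal_imp_subgroup[OF N]]
    by (simp_all add: carrier_Mod)
  have HK: "H \<subseteq> K"
    using \<open>H \<in> N\<close> K(2) by blast
  note K_sub = normal_imp_subgroup[OF K(1)]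
  define C where "C = (\<lambda>g. H #> g) ` K"
  have C: "C \<lhd> G Mod H"
    unfolding C_def by (rule image_normal_Mod[OF K(1)])
  have "\<Union>C = K"
    unfolding C_def by (rule Union_image_cosets[OF K_sub HK])
  moreover have "C \<subseteq> rcosets H"
    using subgroup.subset[OF normal_imp_subgroup[OF C]] by (simp add: carrier_Mod)
  ultimately have cK: "card K = card C * card H"
    using card_Union_cosets[OF assms(1)] by metis
  have pos: "card H > 0"
    using finite_subset[OF subset assms(1)] subgroup.one_closed[OF is_subgroup] card_gt_0_iff by blast
  have "N \<subseteq> C"
  proof
    fix c assume c: "c \<in> N"
    then obtain g where g: "g \<in> carrier G" "c = H #> g"
      using sN by (auto simp: RCOSETS_def)
    then have "g \<in> K"
      using c K(2) rcos_self[OF g(1) is_subgroup] by blast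
    then show "c \<in> C"
      using g by (simp add: C_def)
  qed
  moreover have "card C = m * card N"
    using K(3) cK card_Union_cosets[OF assms(1) sN] pos by simp
  moreover have "Coset.order (G Mod H) = card C * p ^ k"
    using K(5) cK order_Mod[OF assms(1)] pos by (simp add: mult.commute mult.left_commute)
  ultimately show ?thesis
    using C K(4) by (intro p_nilpotent_modI)
qed

lemma p_nilpotent_mod_lift:
  assumes "finite (carrier G)" "p_nilpotent_mod p (G Mod H) {H}"
  shows "p_nilpotent_mod p G H"
proof -
  obtain C m k where C: "C \<lhd> G Mod H" "H \<in> C" "card C = m" "coprime m p"
    "Coset.order (G Mod H) = card C * p ^ k"
    using assms(2) by (auto simp: p_nilpotent_mod_def)
  have "C \<subseteq> rcosets H"
    using subgroup.subset[OF normal_imp_subgroup[OF C(1)]] by (simp add: carrier_Mod)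
  then have "card (\<Union>C) = m * card H"
    using card_Union_cosets[OF assms(1)] C(3) by simp
  moreover have "Coset.order G = card (\<Union>C) * p ^ k"
    using C(3,5) order_Mod[OF assms(1)] calculation by simp
  moreover have "H \<subseteq> \<Union>C"
    using C(2) by blast
  ultimately show ?thesis
    using factgroup_subgroup_union_normal[OF C(1)] C(4) by (intro p_nilpotent_modI)
qed

lemma Mod_commute:
  assumes "derived G A \<subseteq> H" "A \<subseteq> carrier G" "x \<in> (\<lambda>g. H #> g) ` A" "y \<in> (\<lambda>g. H #> g) ` A"
  shows "x \<otimes>\<^bsub>G Mod H\<^esub> y = y \<otimes>\<^bsub>G Mod H\<^esub> x"
proof -
  obtain a b where ab: "a \<in> A" "b \<in> A" "x = H #> a" "y = H #> b"
    using assms(3,4) by blast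
  have c: "a \<in> carrier G" "b \<in> carrier G"
    using ab assms(2) by auto
  let ?c = "a \<otimes> b \<otimes> inv a \<otimes> inv b"
  have "?c \<in> derived_set G A"
    using ab by blast
  then have "?c \<in> derived G A"
    unfolding derived_def by (rule generate.incl)
  then have "?c \<in> H"
    using assms(1) by blast
  have "inv a \<otimes> inv b \<otimes> (b \<otimes> a) = \<one>"
    using c by (simp add: inv_mult_group[symmetric])
  then have "?c \<otimes> (b \<otimes> a) = a \<otimes> b"
    using c m_assoc[of "a \<otimes> b" "inv a \<otimes> inv b" "b \<otimes> a"] m_assoc[of "a \<otimes> b" "inv a" "inv b"] by simp
  then have "H #> (a \<otimes> b) = H #> (?c \<otimes> (b \<otimes> a))"
    by simp
  also have "\<dots> = H #> ?c #> (b \<otimes> a)"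
    using c subset by (simp add: coset_mult_assoc)
  also have "H #> ?c = H"
    using \<open>?c \<in> H\<close> rcos_const[OF is_group] by simp
  finally show ?thesis
    using c ab by (simp add: rcos_sum)
qed

end

section \<open>Choosing a maximal quotient that fails\<close>

context finite_group
begin

text \<open>This replaces induction on the group order, which would change the type of the group
  with every quotient: one normal subgroup \<open>M\<close> of maximal order is chosen inside the
  original group. The predicate \<open>P\<close> restricts the choice and is instantiated both by
  containing the derived subgroup and by lying in the kernel of all linear characters.\<close>

lemma maximal_not_p_nilpotent_mod:
  assumes "\<not> p_nilpotent_mod p G M0" "M0 \<lhd> G" "P M0"
  shows "\<exists>M. M \<lhd> G \<and> P M \<and> \<not> p_nilpotent_mod p (G Mod M) {M} \<and>
    (\<forall>N. N \<lhd> G Mod M \<longrightarrow> N \<noteq> {M} \<longrightarrow> P (\<Union>N) \<longrightarrow> p_nilpotent_mod p (G Mod M) N)"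
proof -
  define S where "S = {M. M \<lhd> G \<and> P M \<and> \<not> p_nilpotent_mod p G M}"
  have "finite S"
    by (rule finite_subset[of _ "Pow (carrier G)"])
      (use fin subgroup.subset normal_imp_subgroup in \<open>auto simp: S_def\<close>)
  moreover have "M0 \<in> S"
    using assms by (simp add: S_def)
  ultimately obtain M where M: "M \<in> S" "Max (card ` S) = card M"
    using obtains_MAX[of S card] by (metis empty_iff)
  have max: "card M' \<le> card M" if "M' \<in> S" for M'
    using Max_ge[of "card ` S" "card M'"] \<open>finite S\<close> that M(2) by simp
  interpret M: normal M G
    using M(1) by (simp add: S_def)
  show ?thesis
  proof (intro exI conjI allI impI)
    show "M \<lhd> G" "P M"
      using M(1) by (simp_all add: S_def)
    show "\<not> p_nilpotent_mod p (G Mod M) {M}"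
      using M(1) M.p_nilpotent_mod_lift[OF fin] by (auto simp: S_def)
    fix N assume N: "N \<lhd> G Mod M" "N \<noteq> {M}" "P (\<Union>N)"
    have sN: "N \<subseteq> rcosets M" and "M \<in> N"
      using subgroup.subset[OF normal_imp_subgroup[OF N(1)]]
        subgroup.one_closed[OF normal_imp_subgroup[OF N(1)]]
      by (simp_all add: M.carrier_Mod)
    have "finite (rcosets M)"
      using fin by (simp add: RCOSETS_def)
    then have "finite N"
      by (rule finite_subset[OF sN])
    moreover have "{M} \<subset> N"
      using N(2) \<open>M \<in> N\<close> by blast
    ultimately have "card N > 1"
      using psubset_card_mono[of N "{M}"] by simp
    moreover have "card M > 0"
      using finite_subset[OF M.subset fin] subgroup.one_closed[OF M.is_subgroup] card_gt_0_iff by blast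
    ultimately have "card (\<Union>N) > card M"
      using M.card_Union_cosets[OF fin sN] by simp
    then have "\<Union>N \<notin> S"
      using max by fastforce
    then have "p_nilpotent_mod p G (\<Union>N)"
      using N M.factgroup_subgroup_union_normal[OF N(1)] by (simp add: S_def)
    then show "p_nilpotent_mod p (G Mod M) N"
      using M.p_nilpotent_mod_quotient[OF fin N(1)] by blast
  qed
qed

text \<open>A counterexample would admit the reduction with the whole abelian quotient as
  \<open>A\<close>, and the reduction produces a subgroup on which conjugation is
  nontrivial.\<close>

lemma p_nilpotent_mod_abelian_quotient:
  assumes "prime p" "M0 \<lhd> G" "derived G (carrier G) \<subseteq> M0"
  shows "p_nilpotent_mod p G M0"
proof (rule ccontr)
  assume "\<not> p_nilpotent_mod p G M0"
  then obtain M where M: "M \<lhd> G" "derived G (carrier G) \<subseteq> M" "\<not> p_nilpotent_mod p (G Mod M) {M}"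
    and quot: "\<forall>N. N \<lhd> G Mod M \<longrightarrow> N \<noteq> {M} \<longrightarrow> derived G (carrier G) \<subseteq> \<Union>N \<longrightarrow>
      p_nilpotent_mod p (G Mod M) N"
    using maximal_not_p_nilpotent_mod[of p M0 "\<lambda>M. derived G (carrier G) \<subseteq> M"] assms(2,3) by blast
  interpret M: normal M G
    by (rule M(1))
  interpret Q: finite_group "G Mod M"
    by (rule M.finite_group_Mod[OF fin])
  have comm: "x \<otimes>\<^bsub>G Mod M\<^esub> y = y \<otimes>\<^bsub>G Mod M\<^esub> x" if "x \<in> carrier (G Mod M)" "y \<in> carrier (G Mod M)" for x y
    using M.Mod_commute[OF M(2)] that by (simp add: carrier_FactGroup)
  have "carrier (G Mod M) \<noteq> {\<one>\<^bsub>G Mod M\<^esub>}"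
    using M(3) Q.p_nilpotent_mod_carrier by auto
  moreover have "p_nilpotent_mod p (G Mod M) N" if "N \<lhd> G Mod M" "N \<noteq> {\<one>\<^bsub>G Mod M\<^esub>}" for N
  proof (rule quot[rule_format])
    show "derived G (carrier G) \<subseteq> \<Union>N"
      using M(2) subgroup.one_closed[OF normal_imp_subgroup[OF that(1)]] by auto
  qed (use that in auto)
  ultimately obtain N where "N \<subseteq> carrier (G Mod M)"
    and nc: "\<not> (\<forall>g\<in>carrier (G Mod M). \<forall>n\<in>N. g \<otimes>\<^bsub>G Mod M\<^esub> n \<otimes>\<^bsub>G Mod M\<^esub> inv\<^bsub>G Mod M\<^esub> g = n)"
    using Q.split_extension_exists[OF assms(1) Q.normal_self _ comm] M(3) by auto
  have "g \<otimes>\<^bsub>G Mod M\<^esub> n \<otimes>\<^bsub>G Mod M\<^esub> inv\<^bsub>G Mod M\<^esub> g = n"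
    if "g \<in> carrier (G Mod M)" "n \<in> carrier (G Mod M)" for g n
    using that unfolding comm[OF that] by (simp add: Q.m_assoc del: mult_FactGroup one_FactGroup)
  then show False
    using nc \<open>N \<subseteq> carrier (G Mod M)\<close> by blast
qed

lemma exp_of_derived_normal: "(derived G ^^ n) (carrier G) \<lhd> G"
  by (induction n) (simp_all add: normal_self derived_is_normal)

text \<open>All linear characters are inflated, so passing from the quotient to \<open>G\<close>
  adds only characters of degree at least 2, whose weights are nonnegative.\<close>

lemma sum_degree_weight_lift:
  assumes "prime p" and M: "M \<lhd> G" and trivial: "\<And>\<mu> x. \<mu> \<in> lin_chars G \<Longrightarrow> x \<in> M \<Longrightarrow> \<mu> x = 1"
    and Q: "0 \<le> (\<Sum>\<chi>\<in>Irr_p' p (G Mod M). (real p + 3) * real (char_degree (G Mod M) \<chi>) - 2 * (real p + 1))"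
  shows "0 \<le> (\<Sum>\<chi>\<in>Irr_p' p G. (real p + 3) * real (char_degree G \<chi>) - 2 * (real p + 1))"
proof -
  interpret M: normal M G
    by (rule M)
  interpret Q: finite_group "G Mod M"
    by (rule M.finite_group_Mod[OF fin])
  let ?I = "M.inflate ` Irr_p' p (G Mod M)"
  have ext: "Irr_p' p (G Mod M) \<subseteq> extensional (carrier (G Mod M))"
    by (auto simp: Irr_p'_def Irr_def character_of_def)
  have finI: "finite (Irr_p' p G)"
    using finite_Irr by (simp add: Irr_p'_def)
  have sub: "?I \<subseteq> Irr_p' p G"
    using M.inflate_Irr by (auto simp: Irr_p'_def)
  have deg: "char_degree G \<chi> \<ge> 2" if \<chi>: "\<chi> \<in> Irr_p' p G - ?I" for \<chi>
  proof -
    have "char_degree G \<chi> \<noteq> 1"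
    proof
      assume "char_degree G \<chi> = 1"
      then have lin: "\<chi> \<in> lin_chars G"
        using \<chi> degree_one_lin_char by (auto simp: Irr_p'_def)
      then obtain \<nu> where \<nu>: "\<nu> \<in> lin_chars (G Mod M)" "M.inflate \<nu> = \<chi>"
        using M.lin_char_deflate trivial by metis
      then have "\<nu> \<in> Irr_p' p (G Mod M)"
        using Q.lin_char_Irr prime_gt_1_nat[OF assms(1)] by (auto simp: Irr_p'_def)
      then show False
        using \<nu> \<chi> by blast
    qed
    moreover have "char_degree G \<chi> > 0"
      using \<chi> char_degree_pos by (auto simp: Irr_p'_def)
    ultimately show ?thesis
      by linarith
  qed
  have "0 \<le> (\<Sum>\<chi>\<in>?I. (real p + 3) * real (char_degree G \<chi>) - 2 * (real p + 1))"
    using Q M.inflate_Irr(2)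
    by (subst sum.reindex[OF inj_on_subset[OF M.inflate_inj ext]]) (auto simp: Irr_p'_def)
  also have "\<dots> \<le> (\<Sum>\<chi>\<in>Irr_p' p G. (real p + 3) * real (char_degree G \<chi>) - 2 * (real p + 1))"
    using finI sub deg by (intro sum_mono2 degree_weight_nonneg)
  finally show ?thesis .
qed

lemma acd_p'_ge:
  assumes "prime p" "0 \<le> (\<Sum>\<chi>\<in>Irr_p' p G. (real p + 3) * real (char_degree G \<chi>) - 2 * (real p + 1))"
  shows "2 * (real p + 1) / (real p + 3) \<le> acd_p' p G"
proof -
  \<comment> \<open>The trivial character makes the denominator positive; division by 0 would give
    an average of 0.\<close>
  have "(\<lambda>x\<in>carrier G. 1) \<in> Irr_p' p G"
    using lin_char_Irr[OF one_lin_char] prime_gt_1_nat[OF assms(1)] by (auto simp: Irr_p'_def)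
  then have "card (Irr_p' p G) > 0"
    using finite_Irr by (auto simp: Irr_p'_def card_gt_0_iff)
  moreover have "0 \<le> (real p + 3) * (\<Sum>\<chi>\<in>Irr_p' p G. real (char_degree G \<chi>)) -
      real (card (Irr_p' p G)) * (2 * (real p + 1))"
    using assms(2) by (simp add: sum_subtractf sum_distrib_left)
  ultimately show ?thesis
    unfolding acd_p'_def by (simp add: divide_simps) (simp add: algebra_simps)
qed

end

theorem theorem1p1:
  fixes G :: "('a, 'b) monoid_scheme" and p :: nat
  assumes "group G"
    and "finite (carrier G)"
    and "solvable G"
    and "prime p"
    and "odd p"
    and "acd_p' p G < 2 * (real p + 1) / (real p + 3)"
  shows "p_nilpotent p G"
proof (rule ccontr)
  assume not_nilp: "\<not> p_nilpotent p G"
  interpret finite_group G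
    using assms(1,2) by (intro finite_group.intro finite_group_axioms.intro)
  \<comment> \<open>This is the condition under which the weight sum lifts from the quotient by
    \<open>M\<close>.\<close>
  let ?P = "\<lambda>M. \<forall>\<mu>\<in>lin_chars G. \<forall>x\<in>M. \<mu> x = 1"
  have "\<not> p_nilpotent_mod p G {\<one>\<^bsub>G\<^esub>}"
    using not_nilp p_nilpotent_mod_one by blast
  moreover have one_P: "?P {\<one>\<^bsub>G\<^esub>}"
    using lin_char_one by simp
  ultimately obtain M where M: "M \<lhd> G" "?P M" "\<not> p_nilpotent_mod p (G Mod M) {M}"
    and quot: "\<forall>N. N \<lhd> G Mod M \<longrightarrow> N \<noteq> {M} \<longrightarrow> ?P (\<Union>N) \<longrightarrow> p_nilpotent_mod p (G Mod M) N"
    using maximal_not_p_nilpotent_mod[of p "{\<one>\<^bsub>G\<^esub>}" ?P, OF _ one_is_normal one_P] by blast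
  interpret M: normal M G
    by (rule M(1))
  interpret Q: finite_group "G Mod M"
    by (rule M.finite_group_Mod[OF fin])
  have not_derived: "\<not> derived G (carrier G) \<subseteq> M"
  proof
    assume "derived G (carrier G) \<subseteq> M"
    then have "derived G (carrier G) \<subseteq> M" "\<Union>{M} = M"
      by auto
    then have "p_nilpotent_mod p (G Mod M) {M}"
      using M.p_nilpotent_mod_quotient[OF fin Q.one_is_normal] p_nilpotent_mod_abelian_quotient[OF assms(4) M(1)]
      by simp
    then show False
      using M(3) by blast
  qed
  define A where "A j = (derived G ^^ j) (carrier G)" for j
  obtain n where "A n = {\<one>\<^bsub>G\<^esub>}"
    using solvable_imp_trivial_derived_seq assms(3) unfolding solvable_def A_def by blast
  then have "A n \<subseteq> M"
    using subgroup.one_closed[OF M.is_subgroup] by simp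
  then have ex: "\<exists>n. A n \<subseteq> M" ..
  \<comment> \<open>The term of the derived series just before \<open>A k\<close> has a nontrivial
    abelian image in the quotient by \<open>M\<close>.\<close>
  define k where "k = (LEAST n. A n \<subseteq> M)"
  have k: "A k \<subseteq> M"
    unfolding k_def by (rule LeastI_ex[OF ex])
  have k_min: "\<not> A j \<subseteq> M" if "j < k" for j
    using that unfolding k_def by (rule not_less_Least)
  have "\<not> carrier G \<subseteq> M"
    using not_derived derived_in_carrier[of "carrier G"] by auto
  then have "k \<noteq> 0" "k \<noteq> 1"
    using k not_derived by (auto simp: A_def)
  \<comment> \<open>Because \<open>k\<close> is at least 2, the term before \<open>A k\<close> lies
    in the derived subgroup, so linear characters are trivial on it.\<close>
  then obtain i where i: "k = Suc (Suc i)"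
    by (metis One_nat_def not0_implies_Suc)
  let ?B = "A (Suc i)"
  have B: "?B \<lhd> G" "\<not> ?B \<subseteq> M" "derived G ?B \<subseteq> M"
    using k k_min[of "Suc i"] i exp_of_derived_normal[of "Suc i"] by (simp_all add: A_def)
  have BG: "?B \<subseteq> carrier G"
    using B(1) normal_imp_subgroup subgroup.subset by blast
  have B_lin: "\<mu> x = 1" if "\<mu> \<in> lin_chars G" "x \<in> ?B" for \<mu> x
  proof -
    have "?B \<subseteq> derived G (carrier G)"
      using mono_derived[of "A i" "carrier G"] exp_of_derived_in_carrier[of "carrier G" i] by (simp add: A_def)
    then show ?thesis
      using lin_char_derived that by blast
  qed
  define C where "C = (\<lambda>g. M #>\<^bsub>G\<^esub> g) ` ?B"
  have C: "C \<lhd> G Mod M"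
    unfolding C_def by (rule M.image_normal_Mod[OF B(1)])
  have C_ne: "C \<noteq> {\<one>\<^bsub>G Mod M\<^esub>}"
  proof
    assume C1: "C = {\<one>\<^bsub>G Mod M\<^esub>}"
    have "x \<in> M" if "x \<in> ?B" for x
      using C1 that BG rcos_self[OF _ M.is_subgroup, of x] by (auto simp: C_def)
    then show False
      using B(2) by blast
  qed
  have C_comm: "x \<otimes>\<^bsub>G Mod M\<^esub> y = y \<otimes>\<^bsub>G Mod M\<^esub> x" if "x \<in> C" "y \<in> C" for x y
    using M.Mod_commute[OF B(3) BG] that by (simp add: C_def)
  have C_quot: "p_nilpotent_mod p (G Mod M) N" if N: "N \<lhd> G Mod M" "N \<noteq> {\<one>\<^bsub>G Mod M\<^esub>}" "N \<subseteq> C" for N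
  proof -
    \<comment> \<open>The preimage of \<open>N\<close> lies in the product of \<open>M\<close> and
      \<open>?B\<close>, and linear characters are trivial on both factors.\<close>
    have "?P (\<Union>N)"
    proof (intro ballI)
      fix \<mu> x assume \<mu>: "\<mu> \<in> lin_chars G" and "x \<in> \<Union>N"
      then obtain b m where "b \<in> ?B" "m \<in> M" "x = m \<otimes>\<^bsub>G\<^esub> b"
        using N(3) by (force simp: C_def r_coset_def)
      then show "\<mu> x = 1"
        using B_lin[OF \<mu>] M(2) \<mu> BG lin_char_mult[OF \<mu>, of m b] by auto
    qed
    moreover have "N \<noteq> {M}"
      using N(2) by simp
    ultimately show ?thesis
      using quot N(1) by blast
  qed
  have Q_not: "\<not> p_nilpotent_mod p (G Mod M) {\<one>\<^bsub>G Mod M\<^esub>}"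
    using M(3) by simp
  obtain N F where split: "split_extension N (G Mod M) F"
    and N: "N \<subseteq> C" "N \<noteq> {\<one>\<^bsub>G Mod M\<^esub>}" "\<forall>n\<in>N. n [^]\<^bsub>G Mod M\<^esub> p = \<one>\<^bsub>G Mod M\<^esub>"
      "\<forall>N'. N' \<lhd> G Mod M \<longrightarrow> N' \<subseteq> N \<longrightarrow> N' = {\<one>\<^bsub>G Mod M\<^esub>} \<or> N' = N"
      "\<not> (\<forall>g\<in>carrier (G Mod M). \<forall>n\<in>N. g \<otimes>\<^bsub>G Mod M\<^esub> n \<otimes>\<^bsub>G Mod M\<^esub> inv\<^bsub>G Mod M\<^esub> g = n)"
    using Q.split_extension_exists[OF assms(4) C C_ne C_comm C_quot Q_not] by blast
  interpret S: split_extension N "G Mod M" F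
    by (rule split)
  have lin_N: "\<nu> x = 1" if \<nu>: "\<nu> \<in> lin_chars (G Mod M)" and "x \<in> N" for \<nu> x
  proof -
    obtain b where b: "b \<in> ?B" "x = M #>\<^bsub>G\<^esub> b"
      using N(1) \<open>x \<in> N\<close> by (auto simp: C_def)
    have "M.inflate \<nu> \<in> lin_chars G"
      using M.inflate_Irr[OF Q.lin_char_Irr(1)[OF \<nu>]] Q.lin_char_Irr(2)[OF \<nu>]
      by (intro degree_one_lin_char) simp_all
    then have "M.inflate \<nu> b = 1"
      using B_lin b(1) by blast
    then show ?thesis
      using b BG by (auto simp: M.inflate_def)
  qed
  have "0 \<le> (\<Sum>\<chi>\<in>Irr_p' p (G Mod M). (real p + 3) * real (char_degree (G Mod M) \<chi>) - 2 * (real p + 1))"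
  proof (rule S.sum_degree_weight_nonneg[OF assms(4,5)])
    show "n [^]\<^bsub>G Mod M\<^esub> p = \<one>\<^bsub>G Mod M\<^esub>" if "n \<in> N" for n
      using N(3) that by blast
    show "N \<noteq> {\<one>\<^bsub>G Mod M\<^esub>}"
      by (rule N(2))
    show "\<nu> n = 1" if "\<nu> \<in> lin_chars (G Mod M)" "n \<in> N" for \<nu> n
      using lin_N that by blast
    show "\<exists>g\<in>carrier (G Mod M). S.act g l \<noteq> l" if "l \<in> lin_chars S.NN" "l \<noteq> (\<lambda>n\<in>N. 1)" for l
      using S.lin_char_moved[OF _ N(5) that] N(4) by blast
  qed
  then have "2 * (real p + 1) / (real p + 3) \<le> acd_p' p G"
    using M(2) by (intro acd_p'_ge[OF assms(4)] sum_degree_weight_lift[OF assms(4) M(1)]) auto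
  then show False
    using assms(6) by simp
qed

end
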